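(* Let $CD\Gamma(N)=(\chi_{bc}^a,A_{jc}^i,H_{jk}^i,C_{j(c)}^{i(k)})$ be an $h$-normal $N$-linear connection of Cartan type on $E^*=J^{1*}(\mathcal T,M)$, and let $X=X^a\frac{\delta}{\delta t^a}+X^i\frac{\delta}{\delta x^i}+X_{(i)}^{(a)}\frac{\partial}{\partial p_i^a}$ be an arbitrary d-vector field on $E^*$. Then the following local Ricci identities hold. ($h_{\mathcal T}$-Ricci identities) $$X_{/b/c}^a-X_{/c/b}^a=X^f\chi_{fbc}^a-X^a|_{(f)}^{(r)}R_{(r)bc}^{(f)},$$ $$X_{/b|k}^a-X_{|k/b}^a=-X_{|r}^aT_{bk}^r-X^a|_{(f)}^{(r)}R_{(r)bk}^{(f)},$$ $$X_{|j|k}^a-X_{|k|j}^a=-X^a|_{(f)}^{(r)}R_{(r)jk}^{(f)},$$ $$X_{/b}^a|_{(c)}^{(k)}-X^a|_{(c)/b}^{(k)}=-X^a|_{(f)}^{(r)}P_{(r)b(c)}^{(f)\ (k)},$$ $$X_{|j}^a|_{(c)}^{(k)}-X^a|_{(c)|j}^{(k)}=-X_{|r}^aC_{j(c)}^{r(k)}-X^a|_{(f)}^{(r)}P_{(r)j(c)}^{(f)\ (k)},$$ $$X^a|_{(b)}^{(j)}|_{(c)}^{(k)}-X^a|_{(c)}^{(k)}|_{(b)}^{(j)}=-X^a|_{(f)}^{(r)}S_{(r)(b)(c)}^{(f)(j)(k)}.$$ ($h_M$-Ricci identities) $$X_{/b/c}^i-X_{/c/b}^i=X^rR_{rbc}^i-X^i|_{(f)}^{(r)}R_{(r)bc}^{(f)},$$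 $$X_{/b|k}^i-X_{|k/b}^i=X^rR_{rbk}^i-X_{|r}^iT_{bk}^r-X^i|_{(f)}^{(r)}R_{(r)bk}^{(f)},$$ $$X_{|j|k}^i-X_{|k|j}^i=X^rR_{rjk}^i-X^i|_{(f)}^{(r)}R_{(r)jk}^{(f)},$$ $$X_{/b}^i|_{(c)}^{(k)}-X^i|_{(c)/b}^{(k)}=X^rP_{rb(c)}^{i\ (k)}-X^i|_{(f)}^{(r)}P_{(r)b(c)}^{(f)\ (k)},$$ $$X_{|j}^i|_{(c)}^{(k)}-X^i|_{(c)|j}^{(k)}=X^rP_{rj(c)}^{i\ (k)}-X_{|r}^iC_{j(c)}^{r(k)}-X^i|_{(f)}^{(r)}P_{(r)j(c)}^{(f)\ (k)},$$ $$X^i|_{(b)}^{(j)}|_{(c)}^{(k)}-X^i|_{(c)}^{(k)}|_{(b)}^{(j)}=X^rS_{r(b)(c)}^{i(j)(k)}-X^i|_{(f)}^{(r)}S_{(r)(b)(c)}^{(f)(j)(k)}.$$ ($v$-Ricci identities) $$X_{(i)/b/c}^{(a)}-X_{(i)/c/b}^{(a)}=X_{(r)}^{(a)}R_{ibc}^r-X_{(i)}^{(f)}\chi_{fbc}^a-X_{(i)}^{(a)}|_{(f)}^{(r)}R_{(r)bc}^{(f)},$$ $$X_{(i)/b|k}^{(a)}-X_{(i)|k/b}^{(a)}=X_{(r)}^{(a)}R_{ibk}^r-X_{(i)|r}^{(a)}T_{bk}^r-X_{(i)}^{(a)}|_{(f)}^{(r)}R_{(r)bk}^{(f)},$$ $$X_{(i)|j|k}^{(a)}-X_{(i)|k|j}^{(a)}=X_{(r)}^{(a)}R_{ijk}^r-X_{(i)}^{(a)}|_{(f)}^{(r)}R_{(r)jk}^{(f)},$$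 $$X_{(i)/b}^{(a)}|_{(c)}^{(k)}-X_{(i)}^{(a)}|_{(c)/b}^{(k)}=X_{(r)}^{(a)}P_{ib(c)}^{r\ (k)}-X_{(i)}^{(a)}|_{(f)}^{(r)}P_{(r)b(c)}^{(f)\ (k)},$$ $$X_{(i)|j}^{(a)}|_{(c)}^{(k)}-X_{(i)}^{(a)}|_{(c)|j}^{(k)}=X_{(r)}^{(a)}P_{ij(c)}^{r\ (k)}-X_{(i)|r}^{(a)}C_{j(c)}^{r(k)}-X_{(i)}^{(a)}|_{(f)}^{(r)}P_{(r)j(c)}^{(f)\ (k)},$$ $$X_{(i)}^{(a)}|_{(b)}^{(j)}|_{(c)}^{(k)}-X_{(i)}^{(a)}|_{(c)}^{(k)}|_{(b)}^{(j)}=X_{(r)}^{(a)}S_{i(b)(c)}^{r(j)(k)}-X_{(i)}^{(a)}|_{(f)}^{(r)}S_{(r)(b)(c)}^{(f)(j)(k)}.$$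
   Context: Setting. $\mathcal{T}$ and $M$ are smooth real manifolds of dimensions $m$ and $n$ with local coordinates $(t^a)$, $(x^i)$; indices $a,b,c,d,e,f,g$ run over $1,\dots,m$ and $i,j,k,l,p,r,s$ over $1,\dots,n$; the Einstein summation convention is used. $E^{*}=J^{1*}(\mathcal{T},M)$ is the dual 1-jet bundle with induced coordinates $(t^a,x^i,p_i^a)$, transforming by $\tilde t^a=\tilde t^a(t^b)$, $\tilde x^i=\tilde x^i(x^j)$, $\tilde p_i^a=\frac{\partial x^j}{\partial\tilde x^i}\frac{\partial\tilde t^a}{\partial t^b}p_j^b$, with $\det(\partial\tilde t^a/\partial t^b)\neq0$ and $\det(\partial\tilde x^i/\partial x^j)\neq0$. Nonlinear connection. $N=(\underset{1}{N}{}_{(i)b}^{(a)},\underset{2}{N}{}_{(i)j}^{(a)})$ is a fixed nonlinear connection on $E^*$, i.e. a collection of local functions with transformation rules $\underset{1}{\tilde N}{}_{(j)c}^{(b)}\frac{\partial\tilde t^c}{\partial t^a}=\underset{1}{N}{}_{(k)a}^{(c)}\frac{\partial\tilde t^b}{\partial t^c}\frac{\partial x^k}{\partial\tilde x^j}-\frac{\partial\tilde p_j^b}{\partial t^a}$ and $\underset{2}{\tilde N}{}_{(j)k}^{(b)}\frac{\partial\tilde x^k}{\partial x^i}=\underset{2}{N}{}_{(k)i}^{(c)}\frac{\partial\tilde t^b}{\partial t^c}\frac{\partial x^k}{\partial\tilde x^j}-\frac{\partial\tilde p_j^b}{\partial x^i}$. The adapted basis is $\frac{\delta}{\delta t^a}=\frac{\partial}{\partial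 t^a}-\underset{1}{N}{}_{(j)a}^{(b)}\frac{\partial}{\partial p_j^b}$, $\frac{\delta}{\delta x^i}=\frac{\partial}{\partial x^i}-\underset{2}{N}{}_{(j)i}^{(b)}\frac{\partial}{\partial p_j^b}$, $\frac{\partial}{\partial p_i^a}$, with dual basis $dt^a$, $dx^i$, $\delta p_i^a=dp_i^a+\underset{1}{N}{}_{(i)b}^{(a)}dt^b+\underset{2}{N}{}_{(i)j}^{(a)}dx^j$. Let $h_{\mathcal T},h_M,v$ be the projections of vector fields onto the spans of $\{\delta/\delta t^a\}$, $\{\delta/\delta x^i\}$, $\{\partial/\partial p_i^a\}$. $N$-linear connection. A linear connection $D$ on $E^*$ with $Dh_{\mathcal T}=0$, $Dh_M=0$, $Dv=0$. Its nine adapted components are defined by $D_{\delta/\delta t^c}\frac{\delta}{\delta t^b}=A_{bc}^a\frac{\delta}{\delta t^a}$, $D_{\delta/\delta t^c}\frac{\delta}{\delta x^j}=A_{jc}^i\frac{\delta}{\delta x^i}$, $D_{\delta/\delta t^c}\frac{\partial}{\partial p_j^b}=-A_{(i)(b)c}^{(a)(j)}\frac{\partial}{\partial p_i^a}$; $D_{\delta/\delta x^k}\frac{\delta}{\delta t^b}=H_{bk}^a\frac{\delta}{\delta t^a}$, $D_{\delta/\delta x^k}\frac{\delta}{\delta x^j}=H_{jk}^i\frac{\delta}{\delta x^i}$, $D_{\delta/\delta x^k}\frac{\partial}{\partial p_j^b}=-H_{(i)(b)k}^{(a)(j)}\frac{\partial}{\partial p_i^a}$; $D_{\partial/\partial p_k^c}\frac{\delta}{\delta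 t^b}=C_{b(c)}^{a(k)}\frac{\delta}{\delta t^a}$, $D_{\partial/\partial p_k^c}\frac{\delta}{\delta x^j}=C_{j(c)}^{i(k)}\frac{\delta}{\delta x^i}$, $D_{\partial/\partial p_k^c}\frac{\partial}{\partial p_j^b}=-C_{(i)(b)(c)}^{(a)(j)(k)}\frac{\partial}{\partial p_i^a}$. $h$-normal. Fix a semi-Riemannian metric $h_{ab}(t)$ on $\mathcal T$ with Christoffel symbols $\chi_{bc}^a(t)$, and let $\mathbb J=h_{ab}\delta_j^i\,\delta p_i^a\otimes dt^b\otimes dx^j$. An $N$-linear connection is $h$-normal if $A_{bc}^a=\chi_{bc}^a$, $H_{bi}^a=0$, $C_{b(c)}^{a(i)}=0$ and $D\mathbb J=0$. For such a connection $A_{(i)(b)c}^{(a)(j)}=\delta_b^aA_{ic}^j-\delta_i^j\chi_{bc}^a$, $H_{(i)(b)k}^{(a)(j)}=\delta_b^aH_{ik}^j$, $C_{(i)(b)(c)}^{(a)(j)(k)}=\delta_b^aC_{i(c)}^{j(k)}$, so it is determined by $(\chi_{bc}^a,A_{jc}^i,H_{jk}^i,C_{j(c)}^{i(k)})$. It is of Cartan type if moreover $H_{jk}^i=H_{kj}^i$ and $C_{j(c)}^{i(k)}=C_{j(c)}^{k(i)}$. Covariant derivatives of d-tensor components. "$_{/g}$", "$_{|s}$", "$|_{(g)}^{(s)}$" denote the adapted components of the covariant derivatives along $\delta/\delta t^g$, $\delta/\delta x^s$, $\partial/\partial p_s^g$. E.g. for components $T_{cj(b)(l)}^{ai(k)(d)}$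 of $\frac{\delta}{\delta t^a}\otimes\frac{\delta}{\delta x^i}\otimes\frac{\partial}{\partial p_l^d}\otimes dt^c\otimes dx^j\otimes\delta p_k^b$, $$T_{cj(b)(l)/g}^{ai(k)(d)}=\tfrac{\delta}{\delta t^g}T_{cj(b)(l)}^{ai(k)(d)}+T_{cj(b)(l)}^{fi(k)(d)}A_{fg}^a+T_{cj(b)(l)}^{ar(k)(d)}A_{rg}^i+T_{cj(f)(l)}^{ai(r)(d)}A_{(r)(b)g}^{(f)(k)}-T_{fj(b)(l)}^{ai(k)(d)}A_{cg}^f-T_{cr(b)(l)}^{ai(k)(d)}A_{jg}^r-T_{cj(b)(r)}^{ai(k)(f)}A_{(l)(f)g}^{(d)(r)},$$ and similarly for any number of indices; "$_{|s}$" is the same with $\delta/\delta x^s$ and the $H$-components $H_{fs}^a,H_{rs}^i,H_{(r)(b)s}^{(f)(k)}$, and "$|_{(g)}^{(s)}$" is the same with $\partial/\partial p_s^g$ and the $C$-components $C_{f(g)}^{a(s)},C_{r(g)}^{i(s)},C_{(r)(b)(g)}^{(f)(k)(s)}$. In iterated derivatives the index produced by the first derivative is treated as a tensor index (a pair $|_{(c)}^{(k)}$ is a $\delta p_k^c$ index). Thus $X^a|_{(c)/b}^{(k)}$ means: first $|_{(c)}^{(k)}$, then $_{/b}$. Torsion d-tensors: $T_{aj}^r=-A_{ja}^r$; $R_{(r)ab}^{(f)}=\frac{\delta \underset{1}{N}{}_{(r)a}^{(f)}}{\delta t^b}-\frac{\delta \underset{1}{N}{}_{(r)b}^{(f)}}{\delta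 t^a}$; $R_{(r)aj}^{(f)}=\frac{\delta \underset{1}{N}{}_{(r)a}^{(f)}}{\delta x^j}-\frac{\delta \underset{2}{N}{}_{(r)j}^{(f)}}{\delta t^a}$; $R_{(r)ij}^{(f)}=\frac{\delta \underset{2}{N}{}_{(r)i}^{(f)}}{\delta x^j}-\frac{\delta \underset{2}{N}{}_{(r)j}^{(f)}}{\delta x^i}$; $P_{(r)a(b)}^{(f)\ (j)}=\frac{\partial \underset{1}{N}{}_{(r)a}^{(f)}}{\partial p_j^b}+\delta_b^fA_{ra}^j-\delta_r^j\chi_{ba}^f$; $P_{(r)i(b)}^{(f)\ (j)}=\frac{\partial \underset{2}{N}{}_{(r)i}^{(f)}}{\partial p_j^b}+\delta_b^fH_{ri}^j$; $S_{(r)(a)(b)}^{(f)(i)(j)}=-(\delta_a^fC_{r(b)}^{i(j)}-\delta_b^fC_{r(a)}^{j(i)})$. Curvature d-tensors: $\chi_{abc}^d=\frac{\delta\chi_{ab}^d}{\delta t^c}-\frac{\delta\chi_{ac}^d}{\delta t^b}+\chi_{ab}^f\chi_{fc}^d-\chi_{ac}^f\chi_{fb}^d$; $R_{ibc}^l=\frac{\delta A_{ib}^l}{\delta t^c}-\frac{\delta A_{ic}^l}{\delta t^b}+A_{ib}^rA_{rc}^l-A_{ic}^rA_{rb}^l+C_{i(f)}^{l(r)}R_{(r)bc}^{(f)}$; $R_{ibk}^l=\frac{\delta A_{ib}^l}{\delta x^k}-\frac{\delta H_{ik}^l}{\delta t^b}+A_{ib}^rH_{rk}^l-H_{ik}^rA_{rb}^l+C_{i(f)}^{l(r)}R_{(r)bk}^{(f)}$;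 $P_{ib(c)}^{l\ (k)}=\frac{\partial A_{ib}^l}{\partial p_k^c}-C_{i(c)/b}^{l(k)}+C_{i(f)}^{l(r)}P_{(r)b(c)}^{(f)\ (k)}$; $R_{ijk}^l=\frac{\delta H_{ij}^l}{\delta x^k}-\frac{\delta H_{ik}^l}{\delta x^j}+H_{ij}^rH_{rk}^l-H_{ik}^rH_{rj}^l+C_{i(f)}^{l(r)}R_{(r)jk}^{(f)}$; $P_{ij(c)}^{l\ (k)}=\frac{\partial H_{ij}^l}{\partial p_k^c}-C_{i(c)|j}^{l(k)}+C_{i(f)}^{l(r)}P_{(r)j(c)}^{(f)\ (k)}$; $S_{i(b)(c)}^{l(j)(k)}=\frac{\partial C_{i(b)}^{l(j)}}{\partial p_k^c}-\frac{\partial C_{i(c)}^{l(k)}}{\partial p_j^b}+C_{i(b)}^{r(j)}C_{r(c)}^{l(k)}-C_{i(c)}^{r(k)}C_{r(b)}^{l(j)}$.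
   Formalization: In the six v-Ricci identities the printed signs of the curvature terms are false; the formal version has -X_(r)^(a) times R, P or S and, in the first, +X_(i)^(f) chi^a_fbc. All other terms are as printed. *)

theory Defs
  imports "HOL-Analysis.Analysis"
begin

section \<open>Smooth maps and smooth manifolds\<close>

text \<open>Maps of class $C^k$, respectively $C^\infty$, on an open subset of a finite-dimensional space.\<close>

primrec Ck_on :: "nat \<Rightarrow> 'u::euclidean_space set \<Rightarrow> ('u \<Rightarrow> 'v::real_normed_vector) \<Rightarrow> bool" where
  "Ck_on 0 S f \<longleftrightarrow> continuous_on S f"
| "Ck_on (Suc k) S f \<longleftrightarrow> (\<forall>x\<in>S. f differentiable (at x)) \<and>
     (\<forall>v. Ck_on k S (\<lambda>x. frechet_derivative f (at x) v))"

definition smooth_on :: "'u::euclidean_space set \<Rightarrow> ('u \<Rightarrow> 'v::real_normed_vector) \<Rightarrow> bool" where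
  "smooth_on S f \<longleftrightarrow> (\<forall>k. Ck_on k S f)"

type_synonym ('a, 'm) chart = "'a set \<times> ('a \<Rightarrow> real^'m)"

definition chart_trans :: "('a, 'm) chart \<Rightarrow> ('a, 'm) chart \<Rightarrow> real^'m \<Rightarrow> real^'m" where
  "chart_trans c c' = snd c' \<circ> inv_into (fst c) (snd c)"

text \<open>The manifold is the whole type of points. No chart is privileged and no maximality is
  required, so that the atlas may in particular be the maximal one.\<close>

definition smooth_atlas ::
    "('a::{t2_space, second_countable_topology}, 'm::finite) chart set \<Rightarrow> bool" where
  "smooth_atlas \<A> \<longleftrightarrow>
     (\<Union>c\<in>\<A>. fst c) = UNIV \<and>
     (\<forall>(U, \<phi>)\<in>\<A>. open U \<and> open (\<phi> ` U) \<and> homeomorphism U (\<phi> ` U) \<phi> (inv_into U \<phi>)) \<and>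
     (\<forall>c\<in>\<A>. \<forall>c'\<in>\<A>. smooth_on (snd c ` (fst c \<inter> fst c')) (chart_trans c c'))"

text \<open>\<open>jac f i j y\<close> is $\partial f^i/\partial y^j$.\<close>

definition jac :: "(real^'k::finite \<Rightarrow> real^'l::finite) \<Rightarrow> 'l \<Rightarrow> 'k \<Rightarrow> real^'k \<Rightarrow> real" where
  "jac f i j y = frechet_derivative f (at y) (axis j 1) $ i"

section \<open>The dual 1-jet bundle\<close>

text \<open>$E^* = J^{1*}(\mathcal T, M)$ is the manifold glued from the coordinate domains
  \<open>jet_dom c\<close>, one for each pair \<open>c\<close> consisting of a chart of $\mathcal T$ and a chart of $M$,
  along the coordinate changes \<open>jet_trans c c'\<close>. A point of a coordinate domain is
  $(t, x, p)$ with \<open>p $ i $ a\<close> standing for $p_i^a$. Geometric objects on $E^*$ are given by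
  their local expressions in all induced charts together with their transformation rules.\<close>

type_synonym ('m, 'n) jet = "(real^'m) \<times> (real^'n) \<times> (real^'m^'n)"

type_synonym ('a, 'm, 'b, 'n) jet_chart = "('a, 'm) chart \<times> ('b, 'n) chart"

definition jet_dom :: "('a, 'm::finite, 'b, 'n::finite) jet_chart \<Rightarrow> ('m, 'n) jet set" where
  "jet_dom c = (snd (fst c) ` fst (fst c)) \<times> (snd (snd c) ` fst (snd c)) \<times> UNIV"

definition jet_overlap :: "('a, 'm::finite, 'b, 'n::finite) jet_chart \<Rightarrow>
    ('a, 'm, 'b, 'n) jet_chart \<Rightarrow> ('m, 'n) jet set" where
  "jet_overlap c c' = (snd (fst c) ` (fst (fst c) \<inter> fst (fst c'))) \<times>
     (snd (snd c) ` (fst (snd c) \<inter> fst (snd c'))) \<times> UNIV"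

definition jet_trans :: "('a, 'm::finite, 'b, 'n::finite) jet_chart \<Rightarrow>
    ('a, 'm, 'b, 'n) jet_chart \<Rightarrow> ('m, 'n) jet \<Rightarrow> ('m, 'n) jet" where
  "jet_trans c c' = (\<lambda>(t, x, p).
     let \<theta> = chart_trans (fst c) (fst c');
         \<xi> = chart_trans (snd c) (snd c');
         \<xi>' = chart_trans (snd c') (snd c)
     in (\<theta> t, \<xi> x, \<chi> i a. \<Sum>j\<in>UNIV. \<Sum>b\<in>UNIV. jac \<xi>' j i (\<xi> x) * jac \<theta> a b t * p $ j $ b))"

text \<open>A vector field on a coordinate domain is the map sending a point to its component vector
  with respect to $\partial/\partial t^a$, $\partial/\partial x^i$, $\partial/\partial p_i^a$.\<close>

type_synonym ('m, 'n) vfield = "('m, 'n) jet \<Rightarrow> ('m, 'n) jet"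

definition lie :: "('m::finite, 'n::finite) vfield \<Rightarrow> (('m, 'n) jet \<Rightarrow> real) \<Rightarrow> ('m, 'n) jet \<Rightarrow> real"
  where "lie Z f e = frechet_derivative f (at e) (Z e)"

definition vector_field :: "('a, 'm::finite) chart set \<Rightarrow> ('b, 'n::finite) chart set \<Rightarrow>
    (('a, 'm, 'b, 'n) jet_chart \<Rightarrow> ('m, 'n) vfield) \<Rightarrow> bool" where
  "vector_field \<A> \<B> X \<longleftrightarrow>
     (\<forall>c\<in>\<A> \<times> \<B>. smooth_on (jet_dom c) (X c)) \<and>
     (\<forall>c\<in>\<A> \<times> \<B>. \<forall>c'\<in>\<A> \<times> \<B>. \<forall>e\<in>jet_overlap c c'.
        X c' (jet_trans c c' e) = frechet_derivative (jet_trans c c') (at e) (X c e))"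

definition pushforward :: "('a, 'm::finite, 'b, 'n::finite) jet_chart \<Rightarrow>
    ('a, 'm, 'b, 'n) jet_chart \<Rightarrow> ('m, 'n) vfield \<Rightarrow> ('m, 'n) vfield" where
  "pushforward c c' X y =
     (let e = jet_trans c' c y in frechet_derivative (jet_trans c c') (at e) (X e))"

section \<open>Nonlinear connections\<close>

text \<open>\<open>N_T N i a b\<close> and \<open>N_M N i a j\<close> stand for
  $\underset{1}{N}{}_{(i)b}^{(a)}$ and $\underset{2}{N}{}_{(i)j}^{(a)}$.\<close>

record ('m, 'n) nlc =
  N_T :: "'n \<Rightarrow> 'm \<Rightarrow> 'm \<Rightarrow> ('m, 'n) jet \<Rightarrow> real"
  N_M :: "'n \<Rightarrow> 'm \<Rightarrow> 'n \<Rightarrow> ('m, 'n) jet \<Rightarrow> real"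

definition nonlinear_connection :: "('a, 'm::finite) chart set \<Rightarrow> ('b, 'n::finite) chart set \<Rightarrow>
    (('a, 'm, 'b, 'n) jet_chart \<Rightarrow> ('m, 'n) nlc) \<Rightarrow> bool" where
  "nonlinear_connection \<A> \<B> N \<longleftrightarrow>
     (\<forall>c\<in>\<A> \<times> \<B>. (\<forall>i a b. smooth_on (jet_dom c) (N_T (N c) i a b)) \<and>
                  (\<forall>i a j. smooth_on (jet_dom c) (N_M (N c) i a j))) \<and>
     (\<forall>c\<in>\<A> \<times> \<B>. \<forall>c'\<in>\<A> \<times> \<B>. \<forall>e\<in>jet_overlap c c'.
        let \<tau> = jet_trans c c';
            \<theta> = chart_trans (fst c) (fst c');
            \<xi> = chart_trans (snd c) (snd c');
            \<xi>' = chart_trans (snd c') (snd c);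
            t = fst e; x = fst (snd e)
        in (\<forall>j b a. (\<Sum>d\<in>UNIV. N_T (N c') j b d (\<tau> e) * jac \<theta> d a t) =
              (\<Sum>k\<in>UNIV. \<Sum>d\<in>UNIV. N_T (N c) k d a e * jac \<theta> b d t * jac \<xi>' k j (\<xi> x))
              - snd (snd (frechet_derivative \<tau> (at e) (axis a 1, 0, 0))) $ j $ b) \<and>
           (\<forall>j b i. (\<Sum>k\<in>UNIV. N_M (N c') j b k (\<tau> e) * jac \<xi> k i x) =
              (\<Sum>k\<in>UNIV. \<Sum>d\<in>UNIV. N_M (N c) k d i e * jac \<theta> b d t * jac \<xi>' k j (\<xi> x))
              - snd (snd (frechet_derivative \<tau> (at e) (0, axis i 1, 0))) $ j $ b))"

text \<open>The adapted basis $\delta/\delta t^a$, $\delta/\delta x^i$, $\partial/\partial p_i^a$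
  and its dual basis $dt^a$, $dx^i$, $\delta p_i^a$.\<close>

definition delta_t :: "('m::finite, 'n::finite) nlc \<Rightarrow> 'm \<Rightarrow> ('m, 'n) vfield" where
  "delta_t N a e = (axis a 1, 0, \<chi> j b. - N_T N j b a e)"

definition delta_x :: "('m::finite, 'n::finite) nlc \<Rightarrow> 'n \<Rightarrow> ('m, 'n) vfield" where
  "delta_x N i e = (0, axis i 1, \<chi> j b. - N_M N j b i e)"

definition part_p :: "'n::finite \<Rightarrow> 'm::finite \<Rightarrow> ('m, 'n) vfield" where
  "part_p i a e = (0, 0, axis i (axis a 1))"

definition dt :: "'m::finite \<Rightarrow> ('m, 'n::finite) jet \<Rightarrow> real" where
  "dt a v = fst v $ a"

definition dx :: "'n::finite \<Rightarrow> ('m::finite, 'n) jet \<Rightarrow> real" where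
  "dx i v = fst (snd v) $ i"

definition delta_p :: "('m::finite, 'n::finite) nlc \<Rightarrow> 'n \<Rightarrow> 'm \<Rightarrow> ('m, 'n) jet \<Rightarrow> ('m, 'n) jet \<Rightarrow> real"
  where "delta_p N i a e v = snd (snd v) $ i $ a
     + (\<Sum>b\<in>UNIV. N_T N i a b e * dt b v) + (\<Sum>j\<in>UNIV. N_M N i a j e * dx j v)"

definition proj_T :: "('m::finite, 'n::finite) nlc \<Rightarrow> ('m, 'n) vfield \<Rightarrow> ('m, 'n) vfield" where
  "proj_T N X e = (\<Sum>a\<in>UNIV. dt a (X e) *\<^sub>R delta_t N a e)"

definition proj_M :: "('m::finite, 'n::finite) nlc \<Rightarrow> ('m, 'n) vfield \<Rightarrow> ('m, 'n) vfield" where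
  "proj_M N X e = (\<Sum>i\<in>UNIV. dx i (X e) *\<^sub>R delta_x N i e)"

definition proj_V :: "('m::finite, 'n::finite) nlc \<Rightarrow> ('m, 'n) vfield \<Rightarrow> ('m, 'n) vfield" where
  "proj_V N X e = (\<Sum>i\<in>UNIV. \<Sum>a\<in>UNIV. delta_p N i a e (X e) *\<^sub>R part_p i a e)"

text \<open>The decomposition $X = X^a\frac{\delta}{\delta t^a} + X^i\frac{\delta}{\delta x^i}
  + X_{(i)}^{(a)}\frac{\partial}{\partial p_i^a}$ with coefficients given by the dual basis.\<close>

lemma adapted_decomposition:
  fixes N :: "('m::finite, 'n::finite) nlc"
  shows "X e = proj_T N X e + proj_M N X e + proj_V N X e"
proof -
  have ax: "axis i (1::real) $ k = (if k = i then 1 else 0)" for i k :: "'k::finite"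
    by (simp add: axis_def)
  have ax2: "axis i (v::real^'m) $ k = (if k = i then v else 0)" for i k :: 'n and v
    by (simp add: axis_def)
  have "fst (X e) $ a = fst (proj_T N X e + proj_M N X e + proj_V N X e) $ a" for a
    by (simp add: proj_T_def proj_M_def proj_V_def delta_t_def delta_x_def part_p_def dt_def
        fst_sum ax if_distrib cong: if_cong)
  moreover have "fst (snd (X e)) $ i = fst (snd (proj_T N X e + proj_M N X e + proj_V N X e)) $ i" for i
    by (simp add: proj_T_def proj_M_def proj_V_def delta_t_def delta_x_def part_p_def dx_def
        fst_sum snd_sum ax if_distrib cong: if_cong)
  moreover have "snd (snd (X e)) $ i $ a
      = snd (snd (proj_T N X e + proj_M N X e + proj_V N X e)) $ i $ a" for i a
  proof -
    have "snd (snd (proj_V N X e)) $ i $ a = delta_p N i a e (X e)"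
    proof -
      have "snd (snd (proj_V N X e)) $ i $ a
          = (\<Sum>j\<in>UNIV. \<Sum>b\<in>UNIV. if j = i then if b = a then delta_p N j b e (X e) else 0 else 0)"
        unfolding proj_V_def part_p_def
        by (simp add: snd_sum) (intro sum.cong refl, auto simp: ax2 ax)
      also have "\<dots> = (\<Sum>j\<in>UNIV. if j = i then delta_p N j a e (X e) else 0)"
        by (intro sum.cong refl) auto
      finally show ?thesis by simp
    qed
    moreover have "snd (snd (proj_T N X e)) $ i $ a = - (\<Sum>b\<in>UNIV. N_T N i a b e * dt b (X e))"
      unfolding proj_T_def delta_t_def by (simp add: snd_sum sum_negf mult.commute)
    moreover have "snd (snd (proj_M N X e)) $ i $ a = - (\<Sum>j\<in>UNIV. N_M N i a j e * dx j (X e))"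
      unfolding proj_M_def delta_x_def by (simp add: snd_sum sum_negf mult.commute)
    ultimately show ?thesis by (simp add: delta_p_def)
  qed
  ultimately show ?thesis by (simp add: prod_eq_iff vec_eq_iff)
qed

section \<open>Linear and \<open>N\<close>-linear connections\<close>

text \<open>A linear connection is given in each induced chart by its action \<open>D W X Y\<close> $= D_X Y$ on the
  smooth vector fields over every open \<open>W\<close> contained in the coordinate domain. This action is
  compatible with restriction and with changes of charts. Only the values on \<open>W\<close> are significant.\<close>

type_synonym ('m, 'n) local_conn =
  "('m, 'n) jet set \<Rightarrow> ('m, 'n) vfield \<Rightarrow> ('m, 'n) vfield \<Rightarrow> ('m, 'n) vfield"

definition local_linear_connection ::
    "('m::finite, 'n::finite) jet set \<Rightarrow> ('m, 'n) local_conn \<Rightarrow> bool" where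
  "local_linear_connection \<Omega> D \<longleftrightarrow>
     (\<forall>W X Y. open W \<and> W \<subseteq> \<Omega> \<and> smooth_on W X \<and> smooth_on W Y \<longrightarrow>
        smooth_on W (D W X Y) \<and>
        (\<forall>X'. smooth_on W X' \<longrightarrow>
           (\<forall>e\<in>W. D W (\<lambda>y. X y + X' y) Y e = D W X Y e + D W X' Y e)) \<and>
        (\<forall>Y'. smooth_on W Y' \<longrightarrow>
           (\<forall>e\<in>W. D W X (\<lambda>y. Y y + Y' y) e = D W X Y e + D W X Y' e)) \<and>
        (\<forall>f. smooth_on W f \<longrightarrow>
           (\<forall>e\<in>W. D W (\<lambda>y. f y *\<^sub>R X y) Y e = f e *\<^sub>R D W X Y e) \<and>
           (\<forall>e\<in>W. D W X (\<lambda>y. f y *\<^sub>R Y y) e = lie X f e *\<^sub>R Y e + f e *\<^sub>R D W X Y e)) \<and>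
        (\<forall>W' X' Y'. open W' \<and> W' \<subseteq> W \<and> (\<forall>e\<in>W'. X' e = X e \<and> Y' e = Y e) \<longrightarrow>
           (\<forall>e\<in>W'. D W' X' Y' e = D W X Y e)))"

definition linear_connection :: "('a, 'm::finite) chart set \<Rightarrow> ('b, 'n::finite) chart set \<Rightarrow>
    (('a, 'm, 'b, 'n) jet_chart \<Rightarrow> ('m, 'n) local_conn) \<Rightarrow> bool" where
  "linear_connection \<A> \<B> D \<longleftrightarrow>
     (\<forall>c\<in>\<A> \<times> \<B>. local_linear_connection (jet_dom c) (D c)) \<and>
     (\<forall>c\<in>\<A> \<times> \<B>. \<forall>c'\<in>\<A> \<times> \<B>. \<forall>W X Y.
        open W \<and> W \<subseteq> jet_overlap c c' \<and> smooth_on W X \<and> smooth_on W Y \<longrightarrow>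
        (\<forall>e\<in>W. D c' (jet_trans c c' ` W) (pushforward c c' X) (pushforward c c' Y) (jet_trans c c' e)
           = frechet_derivative (jet_trans c c') (at e) (D c W X Y e)))"

text \<open>$Dh_{\mathcal T} = 0$, $Dh_M = 0$, $Dv = 0$.\<close>

definition N_linear_connection :: "('a, 'm::finite) chart set \<Rightarrow> ('b, 'n::finite) chart set \<Rightarrow>
    (('a, 'm, 'b, 'n) jet_chart \<Rightarrow> ('m, 'n) nlc) \<Rightarrow>
    (('a, 'm, 'b, 'n) jet_chart \<Rightarrow> ('m, 'n) local_conn) \<Rightarrow> bool" where
  "N_linear_connection \<A> \<B> N D \<longleftrightarrow> linear_connection \<A> \<B> D \<and>
     (\<forall>c\<in>\<A> \<times> \<B>. \<forall>P\<in>{proj_T (N c), proj_M (N c), proj_V (N c)}. \<forall>W X Y.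
        open W \<and> W \<subseteq> jet_dom c \<and> smooth_on W X \<and> smooth_on W Y \<longrightarrow>
        (\<forall>e\<in>W. D c W X (P Y) e = P (D c W X Y) e))"

text \<open>The nine adapted components. Indices are ordered as follows.
  \<open>A_T a b c\<close>: $A_{bc}^a$,
  \<open>A_M i j c\<close>: $A_{jc}^i$,
  \<open>A_V i a b j c\<close>: $A_{(i)(b)c}^{(a)(j)}$,
  and in the same way for \<open>H\<close> with last index \<open>k\<close>, and for \<open>C\<close> with the last two arguments
  \<open>k c\<close> forming the pair ${}_{(c)}^{(k)}$.\<close>

record ('m, 'n) components =
  A_T :: "'m \<Rightarrow> 'm \<Rightarrow> 'm \<Rightarrow> ('m, 'n) jet \<Rightarrow> real"
  A_M :: "'n \<Rightarrow> 'n \<Rightarrow> 'm \<Rightarrow> ('m, 'n) jet \<Rightarrow> real"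
  A_V :: "'n \<Rightarrow> 'm \<Rightarrow> 'm \<Rightarrow> 'n \<Rightarrow> 'm \<Rightarrow> ('m, 'n) jet \<Rightarrow> real"
  H_T :: "'m \<Rightarrow> 'm \<Rightarrow> 'n \<Rightarrow> ('m, 'n) jet \<Rightarrow> real"
  H_M :: "'n \<Rightarrow> 'n \<Rightarrow> 'n \<Rightarrow> ('m, 'n) jet \<Rightarrow> real"
  H_V :: "'n \<Rightarrow> 'm \<Rightarrow> 'm \<Rightarrow> 'n \<Rightarrow> 'n \<Rightarrow> ('m, 'n) jet \<Rightarrow> real"
  C_T :: "'m \<Rightarrow> 'm \<Rightarrow> 'n \<Rightarrow> 'm \<Rightarrow> ('m, 'n) jet \<Rightarrow> real"
  C_M :: "'n \<Rightarrow> 'n \<Rightarrow> 'n \<Rightarrow> 'm \<Rightarrow> ('m, 'n) jet \<Rightarrow> real"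
  C_V :: "'n \<Rightarrow> 'm \<Rightarrow> 'm \<Rightarrow> 'n \<Rightarrow> 'n \<Rightarrow> 'm \<Rightarrow> ('m, 'n) jet \<Rightarrow> real"

text \<open>For an \<open>N\<close>-linear connection $D_{\delta/\delta t^c}\frac{\delta}{\delta t^b}$ lies in the span
  of the $\delta/\delta t^a$, and likewise for the other eight derivatives, so the components are
  obtained by applying the dual basis. The minus signs are those of
  $D_{\delta/\delta t^c}\frac{\partial}{\partial p_j^b} =
    -A_{(i)(b)c}^{(a)(j)}\frac{\partial}{\partial p_i^a}$ etc.\<close>

definition adapted_components :: "('m::finite, 'n::finite) nlc \<Rightarrow> ('m, 'n) local_conn \<Rightarrow>
    ('m, 'n) jet set \<Rightarrow> ('m, 'n) components" where
  "adapted_components N D \<Omega> = \<lparr>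
     A_T = (\<lambda>a b c e. dt a (D \<Omega> (delta_t N c) (delta_t N b) e)),
     A_M = (\<lambda>i j c e. dx i (D \<Omega> (delta_t N c) (delta_x N j) e)),
     A_V = (\<lambda>i a b j c e. - delta_p N i a e (D \<Omega> (delta_t N c) (part_p j b) e)),
     H_T = (\<lambda>a b k e. dt a (D \<Omega> (delta_x N k) (delta_t N b) e)),
     H_M = (\<lambda>i j k e. dx i (D \<Omega> (delta_x N k) (delta_x N j) e)),
     H_V = (\<lambda>i a b j k e. - delta_p N i a e (D \<Omega> (delta_x N k) (part_p j b) e)),
     C_T = (\<lambda>a b k c e. dt a (D \<Omega> (part_p k c) (delta_t N b) e)),
     C_M = (\<lambda>i j k c e. dx i (D \<Omega> (part_p k c) (delta_x N j) e)),
     C_V = (\<lambda>i a b j k c e. - delta_p N i a e (D \<Omega> (part_p k c) (part_p j b) e)) \<rparr>"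

section \<open>Semi-Riemannian metrics and \<open>h\<close>-normal connections\<close>

text \<open>\<open>h c a b t\<close> is $h_{ab}(t)$ in the chart \<open>c\<close> of $\mathcal T$, as a function of the coordinates.\<close>

definition semi_riemannian :: "('a, 'm::finite) chart set \<Rightarrow>
    (('a, 'm) chart \<Rightarrow> 'm \<Rightarrow> 'm \<Rightarrow> real^'m \<Rightarrow> real) \<Rightarrow> bool" where
  "semi_riemannian \<A> h \<longleftrightarrow>
     (\<forall>c\<in>\<A>. (\<forall>a b. smooth_on (snd c ` fst c) (h c a b)) \<and>
        (\<forall>t\<in>snd c ` fst c. (\<forall>a b. h c a b t = h c b a t) \<and> det (\<chi> a b. h c a b t) \<noteq> 0)) \<and>
     (\<forall>c\<in>\<A>. \<forall>c'\<in>\<A>. \<forall>t\<in>snd c ` (fst c \<inter> fst c'). \<forall>a b.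
        h c a b t = (\<Sum>d\<in>UNIV. \<Sum>f\<in>UNIV. h c' d f (chart_trans c c' t)
          * jac (chart_trans c c') d a t * jac (chart_trans c c') f b t))"

definition christoffel :: "('m::finite \<Rightarrow> 'm \<Rightarrow> real^'m \<Rightarrow> real) \<Rightarrow> 'm \<Rightarrow> 'm \<Rightarrow> 'm \<Rightarrow> real^'m \<Rightarrow> real"
  where "christoffel h a b c t = (\<Sum>d\<in>UNIV. matrix_inv (\<chi> a b. h a b t) $ a $ d / 2 *
     (frechet_derivative (h d c) (at t) (axis b 1)
      + frechet_derivative (h d b) (at t) (axis c 1)
      - frechet_derivative (h b c) (at t) (axis d 1)))"

text \<open>$\chi_{bc}^a(t)$ regarded as a function on the coordinate domain in $E^*$.\<close>

definition chris :: "('m::finite \<Rightarrow> 'm \<Rightarrow> real^'m \<Rightarrow> real) \<Rightarrow> 'm \<Rightarrow> 'm \<Rightarrow> 'm \<Rightarrow>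
    ('m, 'n::finite) jet \<Rightarrow> real" where
  "chris h a b c e = christoffel h a b c (fst e)"

text \<open>$\mathbb J = h_{ab}\delta_j^i\,\delta p_i^a \otimes dt^b \otimes dx^j$ evaluated on three
  tangent vectors at \<open>e\<close>.\<close>

definition tensor_J :: "('m::finite, 'n::finite) nlc \<Rightarrow> ('m \<Rightarrow> 'm \<Rightarrow> real^'m \<Rightarrow> real) \<Rightarrow>
    ('m, 'n) jet \<Rightarrow> ('m, 'n) jet \<Rightarrow> ('m, 'n) jet \<Rightarrow> ('m, 'n) jet \<Rightarrow> real" where
  "tensor_J N h e u v w = (\<Sum>a\<in>UNIV. \<Sum>b\<in>UNIV. \<Sum>i\<in>UNIV. \<Sum>j\<in>UNIV.
     h a b (fst e) * of_bool (i = j) * delta_p N i a e u * dt b v * dx j w)"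

definition J_parallel :: "('m::finite, 'n::finite) nlc \<Rightarrow> ('m \<Rightarrow> 'm \<Rightarrow> real^'m \<Rightarrow> real) \<Rightarrow>
    ('m, 'n) jet set \<Rightarrow> ('m, 'n) local_conn \<Rightarrow> bool" where
  "J_parallel N h \<Omega> D \<longleftrightarrow>
     (\<forall>W Z X Y V. open W \<and> W \<subseteq> \<Omega> \<and> smooth_on W Z \<and> smooth_on W X \<and> smooth_on W Y \<and> smooth_on W V
        \<longrightarrow> (\<forall>e\<in>W. lie Z (\<lambda>y. tensor_J N h y (X y) (Y y) (V y)) e
              - tensor_J N h e (D W Z X e) (Y e) (V e)
              - tensor_J N h e (X e) (D W Z Y e) (V e)
              - tensor_J N h e (X e) (Y e) (D W Z V e) = 0))"

definition h_normal :: "('a, 'm::finite) chart set \<Rightarrow> ('b, 'n::finite) chart set \<Rightarrow>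
    (('a, 'm) chart \<Rightarrow> 'm \<Rightarrow> 'm \<Rightarrow> real^'m \<Rightarrow> real) \<Rightarrow>
    (('a, 'm, 'b, 'n) jet_chart \<Rightarrow> ('m, 'n) nlc) \<Rightarrow>
    (('a, 'm, 'b, 'n) jet_chart \<Rightarrow> ('m, 'n) local_conn) \<Rightarrow> bool" where
  "h_normal \<A> \<B> h N D \<longleftrightarrow> N_linear_connection \<A> \<B> N D \<and>
     (\<forall>c\<in>\<A> \<times> \<B>. let \<Gamma> = adapted_components (N c) (D c) (jet_dom c) in
        (\<forall>e\<in>jet_dom c.
           (\<forall>a b d. A_T \<Gamma> a b d e = chris (h (fst c)) a b d e) \<and>
           (\<forall>a b i. H_T \<Gamma> a b i e = 0) \<and>
           (\<forall>a b i d. C_T \<Gamma> a b i d e = 0)) \<and>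
        J_parallel (N c) (h (fst c)) (jet_dom c) (D c))"

definition Cartan_type :: "('a, 'm::finite) chart set \<Rightarrow> ('b, 'n::finite) chart set \<Rightarrow>
    (('a, 'm, 'b, 'n) jet_chart \<Rightarrow> ('m, 'n) nlc) \<Rightarrow>
    (('a, 'm, 'b, 'n) jet_chart \<Rightarrow> ('m, 'n) local_conn) \<Rightarrow> bool" where
  "Cartan_type \<A> \<B> N D \<longleftrightarrow>
     (\<forall>c\<in>\<A> \<times> \<B>. \<forall>e\<in>jet_dom c. let \<Gamma> = adapted_components (N c) (D c) (jet_dom c) in
        (\<forall>i j k. H_M \<Gamma> i j k e = H_M \<Gamma> i k j e) \<and>
        (\<forall>i j k d. C_M \<Gamma> i j k d e = C_M \<Gamma> k j i d e))"

section \<open>Covariant derivatives of d-tensor components\<close>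

text \<open>The components of a d-tensor are indexed by a list of slots. \<open>Up (Ti a)\<close>, \<open>Up (Mi i)\<close>,
  \<open>Up (Vi l d)\<close> are the slots of $\delta/\delta t^a$, $\delta/\delta x^i$,
  $\partial/\partial p_l^d$, and \<open>Dn (Ti c)\<close>, \<open>Dn (Mi j)\<close>, \<open>Dn (Vi k b)\<close> those of $dt^c$, $dx^j$,
  $\delta p_k^b$.\<close>

datatype ('m, 'n) index = Ti 'm | Mi 'n | Vi 'n 'm

datatype ('m, 'n) slot = Up "('m, 'n) index" | Dn "('m, 'n) index"

type_synonym ('m, 'n) dtensor = "('m, 'n) slot list \<Rightarrow> ('m, 'n) jet \<Rightarrow> real"

primrec frame :: "('m::finite, 'n::finite) nlc \<Rightarrow> ('m, 'n) index \<Rightarrow> ('m, 'n) vfield" where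
  "frame N (Ti g) = delta_t N g"
| "frame N (Mi s) = delta_x N s"
| "frame N (Vi s g) = part_p s g"

primrec conn_T :: "('m::finite, 'n::finite) components \<Rightarrow> ('m, 'n) index \<Rightarrow>
    'm \<Rightarrow> 'm \<Rightarrow> ('m, 'n) jet \<Rightarrow> real" where
  "conn_T \<Gamma> (Ti g) a b = A_T \<Gamma> a b g"
| "conn_T \<Gamma> (Mi s) a b = H_T \<Gamma> a b s"
| "conn_T \<Gamma> (Vi s g) a b = C_T \<Gamma> a b s g"

primrec conn_M :: "('m::finite, 'n::finite) components \<Rightarrow> ('m, 'n) index \<Rightarrow>
    'n \<Rightarrow> 'n \<Rightarrow> ('m, 'n) jet \<Rightarrow> real" where
  "conn_M \<Gamma> (Ti g) i j = A_M \<Gamma> i j g"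
| "conn_M \<Gamma> (Mi s) i j = H_M \<Gamma> i j s"
| "conn_M \<Gamma> (Vi s g) i j = C_M \<Gamma> i j s g"

primrec conn_V :: "('m::finite, 'n::finite) components \<Rightarrow> ('m, 'n) index \<Rightarrow>
    'n \<Rightarrow> 'm \<Rightarrow> 'm \<Rightarrow> 'n \<Rightarrow> ('m, 'n) jet \<Rightarrow> real" where
  "conn_V \<Gamma> (Ti g) i a b j = A_V \<Gamma> i a b j g"
| "conn_V \<Gamma> (Mi s) i a b j = H_V \<Gamma> i a b j s"
| "conn_V \<Gamma> (Vi s g) i a b j = C_V \<Gamma> i a b j s g"

text \<open>The connection term contributed by the slot at position \<open>q\<close> to the covariant derivative of
  \<open>T\<close> in the direction \<open>z\<close>.\<close>

definition slot_term :: "('m::finite, 'n::finite) components \<Rightarrow> ('m, 'n) index \<Rightarrow>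
    ('m, 'n) dtensor \<Rightarrow> ('m, 'n) slot list \<Rightarrow> nat \<Rightarrow> ('m, 'n) jet \<Rightarrow> real" where
  "slot_term \<Gamma> z T is q e = (case is ! q of
     Up (Ti a) \<Rightarrow> (\<Sum>f\<in>UNIV. T (is[q := Up (Ti f)]) e * conn_T \<Gamma> z a f e)
   | Up (Mi i) \<Rightarrow> (\<Sum>r\<in>UNIV. T (is[q := Up (Mi r)]) e * conn_M \<Gamma> z i r e)
   | Up (Vi l d) \<Rightarrow> - (\<Sum>r\<in>UNIV. \<Sum>f\<in>UNIV. T (is[q := Up (Vi r f)]) e * conn_V \<Gamma> z l d f r e)
   | Dn (Ti c) \<Rightarrow> - (\<Sum>f\<in>UNIV. T (is[q := Dn (Ti f)]) e * conn_T \<Gamma> z f c e)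
   | Dn (Mi j) \<Rightarrow> - (\<Sum>r\<in>UNIV. T (is[q := Dn (Mi r)]) e * conn_M \<Gamma> z r j e)
   | Dn (Vi k b) \<Rightarrow> (\<Sum>r\<in>UNIV. \<Sum>f\<in>UNIV. T (is[q := Dn (Vi r f)]) e * conn_V \<Gamma> z r f b k e))"

text \<open>\<open>nabla N \<Gamma> T\<close> has one more slot than \<open>T\<close>, appended at the end: its component at
  \<open>is @ [Dn (Ti g)]\<close>, \<open>is @ [Dn (Mi s)]\<close>, \<open>is @ [Dn (Vi s g)]\<close> is
  $T_{/g}$, $T_{|s}$, $T|_{(g)}^{(s)}$, respectively, where $T$ carries the indices \<open>is\<close>.
  For instance $X^a|_{(c)/b}^{(k)}$ is the component of the second iterate at
  \<open>[Up (Ti a), Dn (Vi k c), Dn (Ti b)]\<close>.\<close>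

definition nabla :: "('m::finite, 'n::finite) nlc \<Rightarrow> ('m, 'n) components \<Rightarrow>
    ('m, 'n) dtensor \<Rightarrow> ('m, 'n) dtensor" where
  "nabla N \<Gamma> T js e = (case last js of
     Dn z \<Rightarrow> lie (frame N z) (T (butlast js)) e
              + (\<Sum>q<length (butlast js). slot_term \<Gamma> z T (butlast js) q e)
   | Up z \<Rightarrow> undefined)"

text \<open>The components $X^a$, $X^i$, $X_{(i)}^{(a)}$ of a vector field.\<close>

definition vf_components :: "('m::finite, 'n::finite) nlc \<Rightarrow> ('m, 'n) vfield \<Rightarrow> ('m, 'n) dtensor" where
  "vf_components N X is e = (case is of
     [Up (Ti a)] \<Rightarrow> dt a (X e)
   | [Up (Mi i)] \<Rightarrow> dx i (X e)
   | [Up (Vi i a)] \<Rightarrow> delta_p N i a e (X e)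
   | _ \<Rightarrow> 0)"

text \<open>$C_{i(c)}^{l(k)}$ as a d-tensor.\<close>

definition C_tensor :: "('m::finite, 'n::finite) components \<Rightarrow> ('m, 'n) dtensor" where
  "C_tensor \<Gamma> is e = (case is of
     [Up (Mi l), Dn (Mi i), Dn (Vi k c)] \<Rightarrow> C_M \<Gamma> l i k c e
   | _ \<Rightarrow> 0)"

section \<open>Torsion and curvature d-tensors\<close>

text \<open>Argument order: \<open>tor_T \<Gamma> r a j\<close> is $T_{aj}^r$, \<open>tor_R_TT N r f a b\<close> is $R_{(r)ab}^{(f)}$,
  \<open>tor_P_T h N \<Gamma> r f a j b\<close> is $P_{(r)a(b)}^{(f)\ (j)}$ and
  \<open>tor_S \<Gamma> r f i a j b\<close> is $S_{(r)(a)(b)}^{(f)(i)(j)}$: every pair coming from $p$ is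
  written with its Latin index $i, j, \dots$ of $M$ first.\<close>

definition tor_T :: "('m::finite, 'n::finite) components \<Rightarrow> 'n \<Rightarrow> 'm \<Rightarrow> 'n \<Rightarrow> ('m, 'n) jet \<Rightarrow> real"
  where "tor_T \<Gamma> r a j e = - A_M \<Gamma> r j a e"

definition tor_R_TT :: "('m::finite, 'n::finite) nlc \<Rightarrow> 'n \<Rightarrow> 'm \<Rightarrow> 'm \<Rightarrow> 'm \<Rightarrow> ('m, 'n) jet \<Rightarrow> real"
  where "tor_R_TT N r f a b e =
     lie (delta_t N b) (N_T N r f a) e - lie (delta_t N a) (N_T N r f b) e"

definition tor_R_TM :: "('m::finite, 'n::finite) nlc \<Rightarrow> 'n \<Rightarrow> 'm \<Rightarrow> 'm \<Rightarrow> 'n \<Rightarrow> ('m, 'n) jet \<Rightarrow> real"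
  where "tor_R_TM N r f a j e =
     lie (delta_x N j) (N_T N r f a) e - lie (delta_t N a) (N_M N r f j) e"

definition tor_R_MM :: "('m::finite, 'n::finite) nlc \<Rightarrow> 'n \<Rightarrow> 'm \<Rightarrow> 'n \<Rightarrow> 'n \<Rightarrow> ('m, 'n) jet \<Rightarrow> real"
  where "tor_R_MM N r f i j e =
     lie (delta_x N j) (N_M N r f i) e - lie (delta_x N i) (N_M N r f j) e"

definition tor_P_T :: "('m::finite \<Rightarrow> 'm \<Rightarrow> real^'m \<Rightarrow> real) \<Rightarrow> ('m, 'n::finite) nlc \<Rightarrow>
    ('m, 'n) components \<Rightarrow> 'n \<Rightarrow> 'm \<Rightarrow> 'm \<Rightarrow> 'n \<Rightarrow> 'm \<Rightarrow> ('m, 'n) jet \<Rightarrow> real" where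
  "tor_P_T h N \<Gamma> r f a j b e = lie (part_p j b) (N_T N r f a) e
     + of_bool (b = f) * A_M \<Gamma> j r a e - of_bool (r = j) * chris h f b a e"

definition tor_P_M :: "('m::finite, 'n::finite) nlc \<Rightarrow> ('m, 'n) components \<Rightarrow>
    'n \<Rightarrow> 'm \<Rightarrow> 'n \<Rightarrow> 'n \<Rightarrow> 'm \<Rightarrow> ('m, 'n) jet \<Rightarrow> real" where
  "tor_P_M N \<Gamma> r f i j b e = lie (part_p j b) (N_M N r f i) e + of_bool (b = f) * H_M \<Gamma> j r i e"

definition tor_S :: "('m::finite, 'n::finite) components \<Rightarrow>
    'n \<Rightarrow> 'm \<Rightarrow> 'n \<Rightarrow> 'm \<Rightarrow> 'n \<Rightarrow> 'm \<Rightarrow> ('m, 'n) jet \<Rightarrow> real" where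
  "tor_S \<Gamma> r f i a j b e =
     - (of_bool (a = f) * C_M \<Gamma> i r j b e - of_bool (b = f) * C_M \<Gamma> j r i a e)"

text \<open>Argument order: \<open>cur_chi h N d a b c\<close> is $\chi_{abc}^d$, \<open>cur_R_TT N \<Gamma> l i b c\<close> is
  $R_{ibc}^l$, \<open>cur_P_T h N \<Gamma> l i b k c\<close> is $P_{ib(c)}^{l\ (k)}$,
  and \<open>cur_S \<Gamma> l i j b k c\<close> is $S_{i(b)(c)}^{l(j)(k)}$.

  Signs: the vertical component $X_{(i)}^{(a)}$ is covariant in its $M$-index and contravariant in
  its $\mathcal T$-index. With these curvature tensors and the derivatives defined above, the Ricci
  identities for $X_{(i)}^{(a)}$ therefore contain $-X_{(r)}^{(a)}R_{ibc}^r$ and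
  $+X_{(i)}^{(f)}\chi_{fbc}^a$ (and similarly $-X_{(r)}^{(a)}P_{ib(c)}^{r\ (k)}$ etc.). The source
  prints these curvature terms with the opposite sign, which is inconsistent with the sign in
  $D\frac{\partial}{\partial p_j^b} = -A_{(i)(b)}^{(a)(j)}\frac{\partial}{\partial p_i^a}$.\<close>

definition cur_chi :: "('m::finite \<Rightarrow> 'm \<Rightarrow> real^'m \<Rightarrow> real) \<Rightarrow> ('m, 'n::finite) nlc \<Rightarrow>
    'm \<Rightarrow> 'm \<Rightarrow> 'm \<Rightarrow> 'm \<Rightarrow> ('m, 'n) jet \<Rightarrow> real" where
  "cur_chi h N d a b c e = lie (delta_t N c) (chris h d a b) e - lie (delta_t N b) (chris h d a c) e
     + (\<Sum>f\<in>UNIV. chris h f a b e * chris h d f c e) - (\<Sum>f\<in>UNIV. chris h f a c e * chris h d f b e)"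

definition cur_R_TT :: "('m::finite, 'n::finite) nlc \<Rightarrow> ('m, 'n) components \<Rightarrow>
    'n \<Rightarrow> 'n \<Rightarrow> 'm \<Rightarrow> 'm \<Rightarrow> ('m, 'n) jet \<Rightarrow> real" where
  "cur_R_TT N \<Gamma> l i b c e = lie (delta_t N c) (A_M \<Gamma> l i b) e - lie (delta_t N b) (A_M \<Gamma> l i c) e
     + (\<Sum>r\<in>UNIV. A_M \<Gamma> r i b e * A_M \<Gamma> l r c e) - (\<Sum>r\<in>UNIV. A_M \<Gamma> r i c e * A_M \<Gamma> l r b e)
     + (\<Sum>r\<in>UNIV. \<Sum>f\<in>UNIV. C_M \<Gamma> l i r f e * tor_R_TT N r f b c e)"

definition cur_R_TM :: "('m::finite, 'n::finite) nlc \<Rightarrow> ('m, 'n) components \<Rightarrow>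
    'n \<Rightarrow> 'n \<Rightarrow> 'm \<Rightarrow> 'n \<Rightarrow> ('m, 'n) jet \<Rightarrow> real" where
  "cur_R_TM N \<Gamma> l i b k e = lie (delta_x N k) (A_M \<Gamma> l i b) e - lie (delta_t N b) (H_M \<Gamma> l i k) e
     + (\<Sum>r\<in>UNIV. A_M \<Gamma> r i b e * H_M \<Gamma> l r k e) - (\<Sum>r\<in>UNIV. H_M \<Gamma> r i k e * A_M \<Gamma> l r b e)
     + (\<Sum>r\<in>UNIV. \<Sum>f\<in>UNIV. C_M \<Gamma> l i r f e * tor_R_TM N r f b k e)"

definition cur_P_T :: "('m::finite \<Rightarrow> 'm \<Rightarrow> real^'m \<Rightarrow> real) \<Rightarrow> ('m, 'n::finite) nlc \<Rightarrow>
    ('m, 'n) components \<Rightarrow> 'n \<Rightarrow> 'n \<Rightarrow> 'm \<Rightarrow> 'n \<Rightarrow> 'm \<Rightarrow> ('m, 'n) jet \<Rightarrow> real" where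
  "cur_P_T h N \<Gamma> l i b k c e = lie (part_p k c) (A_M \<Gamma> l i b) e
     - nabla N \<Gamma> (C_tensor \<Gamma>) [Up (Mi l), Dn (Mi i), Dn (Vi k c), Dn (Ti b)] e
     + (\<Sum>r\<in>UNIV. \<Sum>f\<in>UNIV. C_M \<Gamma> l i r f e * tor_P_T h N \<Gamma> r f b k c e)"

definition cur_R_MM :: "('m::finite, 'n::finite) nlc \<Rightarrow> ('m, 'n) components \<Rightarrow>
    'n \<Rightarrow> 'n \<Rightarrow> 'n \<Rightarrow> 'n \<Rightarrow> ('m, 'n) jet \<Rightarrow> real" where
  "cur_R_MM N \<Gamma> l i j k e = lie (delta_x N k) (H_M \<Gamma> l i j) e - lie (delta_x N j) (H_M \<Gamma> l i k) e
     + (\<Sum>r\<in>UNIV. H_M \<Gamma> r i j e * H_M \<Gamma> l r k e) - (\<Sum>r\<in>UNIV. H_M \<Gamma> r i k e * H_M \<Gamma> l r j e)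
     + (\<Sum>r\<in>UNIV. \<Sum>f\<in>UNIV. C_M \<Gamma> l i r f e * tor_R_MM N r f j k e)"

definition cur_P_M :: "('m::finite, 'n::finite) nlc \<Rightarrow> ('m, 'n) components \<Rightarrow>
    'n \<Rightarrow> 'n \<Rightarrow> 'n \<Rightarrow> 'n \<Rightarrow> 'm \<Rightarrow> ('m, 'n) jet \<Rightarrow> real" where
  "cur_P_M N \<Gamma> l i j k c e = lie (part_p k c) (H_M \<Gamma> l i j) e
     - nabla N \<Gamma> (C_tensor \<Gamma>) [Up (Mi l), Dn (Mi i), Dn (Vi k c), Dn (Mi j)] e
     + (\<Sum>r\<in>UNIV. \<Sum>f\<in>UNIV. C_M \<Gamma> l i r f e * tor_P_M N \<Gamma> r f j k c e)"

definition cur_S :: "('m::finite, 'n::finite) components \<Rightarrow>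
    'n \<Rightarrow> 'n \<Rightarrow> 'n \<Rightarrow> 'm \<Rightarrow> 'n \<Rightarrow> 'm \<Rightarrow> ('m, 'n) jet \<Rightarrow> real" where
  "cur_S \<Gamma> l i j b k c e = lie (part_p k c) (C_M \<Gamma> l i j b) e - lie (part_p j b) (C_M \<Gamma> l i k c) e
     + (\<Sum>r\<in>UNIV. C_M \<Gamma> r i j b e * C_M \<Gamma> l r k c e) - (\<Sum>r\<in>UNIV. C_M \<Gamma> r i k c e * C_M \<Gamma> l r j b e)"

end

theory Submission
  imports Defs
begin

text \<open>All frame fields can be treated at once: with the connection coefficients \<open>conn\<close> of the adapted
  frame, a commutator of second covariant derivatives of $X$ is the commutator of two frame fields
  applied to a component of $X$, plus terms that are algebraic in $X$ and in its first derivatives.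
  Since only the vertical parts of the frame fields vary, their brackets are vertical; replacing
  $\partial X/\partial p$ by $X|$ minus its connection term turns the bracket into a torsion term plus
  the term $C \cdot R$ (or $C \cdot P$) of the curvature. The eighteen identities are the three types
  of components of $X$ combined with the six pairs of directions. The vertical
  coefficients are first expressed by those of the $\mathcal T$- and $M$-parts through
  $D\mathbb J = 0$.\<close>

section \<open>Calculus of smooth maps\<close>

text \<open>All frame brackets being vertical, the torsion has T- and M-components only through
  connection coefficients. The symmetry of the Christoffel symbols and of \<open>H_M\<close> removes
  these for two directions of the same horizontal kind; \<open>tor_T\<close> and the term with
  \<open>C_M\<close> are what is left of them. The curvature \<open>cur_chi\<close> appears only for
  a pair of T-directions because the Christoffel symbols depend on t alone. On vertical components
  the connection acts on the M-index through the dual representation, which reverses the sign of the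
  M-curvature: the last six identities therefore carry -X R and +X chi, opposite to the signs
  displayed in the English statement. The analytic obstacle is twofold. Relations between
  coefficients are known only on the coordinate domain, so each one is differentiated by way of the
  openness of that domain. And smoothness is phrased by iterated derivatives along constant
  directions, whereas the frame fields vary from point to point; their commutators are reduced to
  the symmetry of mixed derivatives in constant directions.\<close>

lemma Ck_on_cong:
  assumes "open S" and "\<And>x. x \<in> S \<Longrightarrow> f x = g x"
  shows "Ck_on k S f \<longleftrightarrow> Ck_on k S g"
  using assms(2)
proof (induction k arbitrary: f g)
  case 0
  then show ?case by (simp cong: continuous_on_cong)
next
  case (Suc k)
  have fd: "frechet_derivative f (at x) = frechet_derivative g (at x)"
    and d: "f differentiable at x \<longleftrightarrow> g differentiable at x" if "x \<in> S" for x
  proof -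
    have imp: "f' differentiable at x \<Longrightarrow> g' differentiable at x"
      if "\<And>y. y \<in> S \<Longrightarrow> f' y = g' y" for f' g' :: "'a \<Rightarrow> 'b"
      using that \<open>x \<in> S\<close> \<open>open S\<close> unfolding differentiable_def
      by (meson has_derivative_transform_within_open)
    show d: "f differentiable at x \<longleftrightarrow> g differentiable at x"
      using imp[of f g] imp[of g f] Suc.prems by auto
    show "frechet_derivative f (at x) = frechet_derivative g (at x)"
    proof (cases "f differentiable at x")
      case True
      then show ?thesis
        using frechet_derivative_transform_within_open[OF _ \<open>open S\<close> that] Suc.prems by blast
    next
      \<comment> \<open>At such a point \<open>frechet_derivative\<close> is a choice from a
        predicate that no map satisfies. The predicate is the same for \<open>f\<close> and
        \<open>g\<close>, hence so is the chosen map.\<close>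
      case False
      then have "(f has_derivative h) (at x) \<longleftrightarrow> (g has_derivative h) (at x)" for h
        using d by (auto simp: differentiable_def)
      then show ?thesis unfolding frechet_derivative_def by simp
    qed
  qed
  have "Ck_on k S (\<lambda>x. frechet_derivative f (at x) v) \<longleftrightarrow>
        Ck_on k S (\<lambda>x. frechet_derivative g (at x) v)" for v
    by (rule Suc.IH) (simp add: fd)
  then show ?case using d by auto
qed

text \<open>With the derivative given by a formula, the closure proofs below can quote the usual
  derivative rules instead of arguing about the map chosen by
  \<open>frechet_derivative\<close>.\<close>

lemma Ck_on_SucI:
  assumes "open S" and "\<And>x. x \<in> S \<Longrightarrow> (f has_derivative f' x) (at x)"
    and "\<And>v. Ck_on k S (\<lambda>x. f' x v)"
  shows "Ck_on (Suc k) S f"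
proof -
  have "Ck_on k S (\<lambda>x. frechet_derivative f (at x) v)" for v
    using assms(3)[of v] frechet_derivative_at[OF assms(2)]
    by (subst Ck_on_cong[OF assms(1), where g = "\<lambda>x. f' x v"]) auto
  then show ?thesis using assms(2) by (auto simp: differentiable_def)
qed

lemma Ck_on_imp_differentiable:
  "Ck_on (Suc k) S f \<Longrightarrow> x \<in> S \<Longrightarrow> f differentiable at x"
  by simp

lemma Ck_on_SucD: "Ck_on (Suc k) S f \<Longrightarrow> Ck_on k S f"
proof (induction k arbitrary: f)
  case 0
  then show ?case
    by (auto intro!: continuous_at_imp_continuous_on differentiable_imp_continuous_within)
next
  case (Suc k)
  then show ?case by (metis Ck_on.simps(2))
qed

lemma Ck_on_const: "Ck_on k S (\<lambda>x. c)"
  by (induction k arbitrary: c) auto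

lemma Ck_on_bounded_linear:
  assumes "bounded_linear L" and "open S" and "Ck_on k S f"
  shows "Ck_on k S (\<lambda>x. L (f x))"
  using assms(3)
proof (induction k arbitrary: f)
  case 0
  then show ?case using bounded_linear.continuous_on[OF assms(1)] by auto
next
  case (Suc k)
  show ?case
    by (rule Ck_on_SucI[OF assms(2), where f' = "\<lambda>x v. L (frechet_derivative f (at x) v)"])
      (use Suc in \<open>auto intro: bounded_linear.has_derivative[OF assms(1)] simp: frechet_derivative_works\<close>)
qed

lemma Ck_on_add:
  assumes "open S" and "Ck_on k S f" and "Ck_on k S g"
  shows "Ck_on k S (\<lambda>x. f x + g x)"
  using assms(2,3)
proof (induction k arbitrary: f g)
  case 0
  then show ?case by (auto intro: continuous_on_add)
next
  case (Suc k)
  show ?case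
    by (rule Ck_on_SucI[OF assms(1), where
          f' = "\<lambda>x v. frechet_derivative f (at x) v + frechet_derivative g (at x) v"])
      (use Suc in \<open>auto intro: has_derivative_add simp: frechet_derivative_works\<close>)
qed

lemma Ck_on_bilinear:
  assumes "bounded_bilinear B" and "open S" and "Ck_on k S f" and "Ck_on k S g"
  shows "Ck_on k S (\<lambda>x. B (f x) (g x))"
  using assms(3,4)
proof (induction k arbitrary: f g)
  case 0
  then show ?case using bounded_bilinear.continuous_on[OF assms(1)] by auto
next
  case (Suc k)
  show ?case
  proof (rule Ck_on_SucI[OF assms(2), where
        f' = "\<lambda>x v. B (f x) (frechet_derivative g (at x) v) + B (frechet_derivative f (at x) v) (g x)"])
    show "((\<lambda>x. B (f x) (g x)) has_derivative
        (\<lambda>v. B (f x) (frechet_derivative g (at x) v) + B (frechet_derivative f (at x) v) (g x))) (at x)"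
      if "x \<in> S" for x
      by (rule bounded_bilinear.FDERIV[OF assms(1)]) (use Suc.prems that in \<open>auto simp: frechet_derivative_works\<close>)
    \<comment> \<open>The product rule leaves one factor undifferentiated in each summand;
      \<open>Ck_on_SucD\<close> lowers its order to the one that the induction hypothesis asks
      for.\<close>
    show "Ck_on k S (\<lambda>x. B (f x) (frechet_derivative g (at x) v) + B (frechet_derivative f (at x) v) (g x))"
      for v
      by (intro Ck_on_add[OF assms(2)] Suc.IH Ck_on_SucD[OF Suc.prems(1)] Ck_on_SucD[OF Suc.prems(2)])
        (use Suc.prems in auto)
  qed
qed

lemma smooth_on_const: "smooth_on S (\<lambda>x. c)"
  by (simp add: smooth_on_def Ck_on_const)

lemma smooth_on_bounded_linear:
  "bounded_linear L \<Longrightarrow> open S \<Longrightarrow> smooth_on S f \<Longrightarrow> smooth_on S (\<lambda>x. L (f x))"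
  by (simp add: smooth_on_def Ck_on_bounded_linear)

lemma smooth_on_add:
  "open S \<Longrightarrow> smooth_on S f \<Longrightarrow> smooth_on S g \<Longrightarrow> smooth_on S (\<lambda>x. f x + g x)"
  by (simp add: smooth_on_def Ck_on_add)

lemma smooth_on_bilinear:
  "bounded_bilinear B \<Longrightarrow> open S \<Longrightarrow> smooth_on S f \<Longrightarrow> smooth_on S g \<Longrightarrow>
    smooth_on S (\<lambda>x. B (f x) (g x))"
  by (simp add: smooth_on_def Ck_on_bilinear)

lemma smooth_on_sum:
  assumes "open S" and "\<And>i. i \<in> I \<Longrightarrow> smooth_on S (f i)"
  shows "smooth_on S (\<lambda>x. \<Sum>i\<in>I. f i x)"
  using assms(2)
proof (induction I rule: infinite_finite_induct)
  case (insert i I)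
  then show ?case by (simp add: smooth_on_add[OF assms(1)])
qed (simp_all add: smooth_on_const)

lemma smooth_on_imp_differentiable: "smooth_on S f \<Longrightarrow> x \<in> S \<Longrightarrow> f differentiable at x"
  unfolding smooth_on_def using Ck_on_imp_differentiable by blast

text \<open>Two applications of the mean value theorem write the second difference of \<open>f\<close> as $t^2$ times
  a mixed derivative near \<open>e\<close>.\<close>

lemma second_difference:
  fixes f :: "'u::euclidean_space \<Rightarrow> real"
  assumes f: "Ck_on 2 S f" and "0 < t"
    and S: "\<And>s s'. 0 \<le> s \<Longrightarrow> s \<le> t \<Longrightarrow> 0 \<le> s' \<Longrightarrow> s' \<le> t \<Longrightarrow> e + s *\<^sub>R u + s' *\<^sub>R v \<in> S"
  obtains s s' where "0 \<le> s" "s \<le> t" "0 \<le> s'" "s' \<le> t"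
    and "f (e + t *\<^sub>R u + t *\<^sub>R v) - f (e + t *\<^sub>R u) - f (e + t *\<^sub>R v) + f e =
      t * t * frechet_derivative (\<lambda>y. frechet_derivative f (at y) u) (at (e + s *\<^sub>R u + s' *\<^sub>R v)) v"
proof -
  let ?d = "\<lambda>y. frechet_derivative f (at y) u"
  have D: "(f has_derivative frechet_derivative f (at y)) (at y)"
    and D2: "(?d has_derivative frechet_derivative ?d (at y)) (at y)" if "y \<in> S" for y
    using f that by (auto simp: numeral_2_eq_2 frechet_derivative_works)
  have line: "((\<lambda>s. F (p + s *\<^sub>R w)) has_field_derivative frechet_derivative F (at (p + s *\<^sub>R w)) w) (at s)"
    if "(F has_derivative frechet_derivative F (at (p + s *\<^sub>R w))) (at (p + s *\<^sub>R w))"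
    for F :: "'u \<Rightarrow> real" and p w s
  proof -
    have "((\<lambda>s. p + s *\<^sub>R w) has_derivative (\<lambda>h. h *\<^sub>R w)) (at s)"
      by (auto intro!: derivative_eq_intros)
    from has_derivative_compose[OF this that] show ?thesis
      unfolding has_field_derivative_def
      by (rule has_derivative_eq_rhs) (simp add: fun_eq_iff linear_cmul[OF has_derivative_linear[OF that]])
  qed
  let ?g = "\<lambda>s. f ((e + t *\<^sub>R v) + s *\<^sub>R u) - f (e + s *\<^sub>R u)"
  have "\<exists>s>0. s < t \<and> ?g t - ?g 0 = (t - 0) * (?d ((e + t *\<^sub>R v) + s *\<^sub>R u) - ?d (e + s *\<^sub>R u))"
  proof (rule MVT2[OF \<open>0 < t\<close>])
    fix s assume s: "0 \<le> s" "s \<le> t"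
    show "(?g has_field_derivative (?d ((e + t *\<^sub>R v) + s *\<^sub>R u) - ?d (e + s *\<^sub>R u))) (at s)"
      by (intro DERIV_diff line D) (use S[of s t] S[of s 0] s \<open>0 < t\<close> in \<open>auto simp: add_ac\<close>)
  qed
  then obtain s where s: "0 < s" "s < t"
    and gs: "?g t - ?g 0 = t * (?d ((e + t *\<^sub>R v) + s *\<^sub>R u) - ?d (e + s *\<^sub>R u))" by auto
  have "\<exists>s'>0. s' < t \<and> ?d ((e + s *\<^sub>R u) + t *\<^sub>R v) - ?d ((e + s *\<^sub>R u) + 0 *\<^sub>R v) =
      (t - 0) * frechet_derivative ?d (at ((e + s *\<^sub>R u) + s' *\<^sub>R v)) v"
    by (rule MVT2[OF \<open>0 < t\<close>]) (intro line D2 S, use s in auto)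
  then obtain s' where s': "0 < s'" "s' < t" and ds: "?d ((e + s *\<^sub>R u) + t *\<^sub>R v) - ?d (e + s *\<^sub>R u) =
      t * frechet_derivative ?d (at ((e + s *\<^sub>R u) + s' *\<^sub>R v)) v" by auto
  have "(e + t *\<^sub>R v) + s *\<^sub>R u = (e + s *\<^sub>R u) + t *\<^sub>R v" by (simp add: algebra_simps)
  then have "?g t - ?g 0 = t * t * frechet_derivative ?d (at ((e + s *\<^sub>R u) + s' *\<^sub>R v)) v"
    by (simp only: gs ds mult.assoc)
  moreover have "?g t - ?g 0 = f (e + t *\<^sub>R u + t *\<^sub>R v) - f (e + t *\<^sub>R u) - f (e + t *\<^sub>R v) + f e"
    by (simp add: algebra_simps)
  ultimately show ?thesis using that[of s s'] s s' by auto
qed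

text \<open>The second difference over the parallelogram with sides t u and t v is unchanged when u
  and v are exchanged. So the two mixed derivatives share a value at points near \<open>e\<close>,
  and continuity excludes different values at \<open>e\<close>.\<close>

lemma mixed_derivatives_commute:
  fixes f :: "'u::euclidean_space \<Rightarrow> real"
  assumes "open S" and "e \<in> S" and f: "Ck_on 2 S f"
  shows "frechet_derivative (\<lambda>y. frechet_derivative f (at y) u) (at e) v =
    frechet_derivative (\<lambda>y. frechet_derivative f (at y) v) (at e) u"
proof (rule ccontr)
  define F where "F u v y = frechet_derivative (\<lambda>y. frechet_derivative f (at y) u) (at y) v" for u v y
  assume "\<not> ?thesis"
  then have pos: "\<bar>F u v e - F v u e\<bar> / 2 > 0" by (simp add: F_def)
  \<comment> \<open>Half the gap: one number cannot lie strictly within this distance of both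
    \<open>F u v e\<close> and \<open>F v u e\<close>.\<close>
  define \<epsilon> where "\<epsilon> = \<bar>F u v e - F v u e\<bar> / 2"
  have cont: "isCont (F u v) e" for u v
    using f \<open>open S\<close> \<open>e \<in> S\<close> by (auto simp: F_def[abs_def] numeral_2_eq_2 continuous_on_eq_continuous_at)
  have near: "\<exists>d>0. \<forall>y. dist y e < d \<longrightarrow> dist (F u v y) (F u v e) < \<epsilon>" for u v
    using cont[of u v] pos unfolding \<epsilon>_def continuous_at by (metis dist_self Lim_at dist_nz)
  obtain d1 where d1: "d1 > 0" "\<And>y. dist y e < d1 \<Longrightarrow> dist (F u v y) (F u v e) < \<epsilon>"
    using near by blast
  obtain d2 where d2: "d2 > 0" "\<And>y. dist y e < d2 \<Longrightarrow> dist (F v u y) (F v u e) < \<epsilon>"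
    using near by blast
  obtain d3 where d3: "d3 > 0" "\<And>y. dist y e < d3 \<Longrightarrow> y \<in> S"
    using assms(1,2) unfolding open_dist by blast
  define d where "d = min d1 (min d2 d3)"
  \<comment> \<open>The points of the parallelogram stay within \<open>t * K = d / 2\<close> of
    \<open>e\<close>; the summand 1 keeps \<open>K\<close> positive when both vectors
    vanish.\<close>
  define K where "K = 1 + norm u + norm v"
  define t where "t = d / K / 2"
  have d: "d > 0" using d1 d2 d3 by (simp add: d_def)
  have npos: "K > 0" unfolding K_def by (smt (verit) norm_ge_zero)
  then have t: "t > 0" using d by (simp add: t_def)
  have small: "dist (e + s *\<^sub>R u + s' *\<^sub>R v) e < d" if "0 \<le> s" "s \<le> t" "0 \<le> s'" "s' \<le> t" for s s'
  proof -
    have "dist (e + s *\<^sub>R u + s' *\<^sub>R v) e \<le> s * norm u + s' * norm v"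
      using norm_triangle_ineq[of "s *\<^sub>R u" "s' *\<^sub>R v"] that by (simp add: dist_norm)
    also have "\<dots> \<le> t * norm u + t * norm v" using that by (intro add_mono mult_right_mono) auto
    also have "\<dots> \<le> t * K" using t by (simp add: K_def algebra_simps)
    also have "\<dots> = d / 2" using npos by (simp add: t_def)
    finally show ?thesis using d by simp
  qed
  obtain s1 s1' where 1: "0 \<le> s1" "s1 \<le> t" "0 \<le> s1'" "s1' \<le> t"
    and e1: "f (e + t *\<^sub>R u + t *\<^sub>R v) - f (e + t *\<^sub>R u) - f (e + t *\<^sub>R v) + f e =
      t * t * F u v (e + s1 *\<^sub>R u + s1' *\<^sub>R v)"
    using second_difference[OF f t, of e u v] small d3 unfolding F_def d_def
    by (metis min_less_iff_conj)
  have swap: "e + s *\<^sub>R v + s' *\<^sub>R u = e + s' *\<^sub>R u + s *\<^sub>R v" for s s' by (simp add: algebra_simps)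
  obtain s2 s2' where 2: "0 \<le> s2" "s2 \<le> t" "0 \<le> s2'" "s2' \<le> t"
    and e2: "f (e + t *\<^sub>R v + t *\<^sub>R u) - f (e + t *\<^sub>R v) - f (e + t *\<^sub>R u) + f e =
      t * t * F v u (e + s2 *\<^sub>R v + s2' *\<^sub>R u)"
    using second_difference[OF f t, of e v u] small d3 unfolding F_def d_def
    by (metis swap min_less_iff_conj)
  have "t * t * F u v (e + s1 *\<^sub>R u + s1' *\<^sub>R v) = t * t * F v u (e + s2 *\<^sub>R v + s2' *\<^sub>R u)"
    using e1 e2[unfolded swap[of t t]] by linarith
  then have "F u v (e + s1 *\<^sub>R u + s1' *\<^sub>R v) = F v u (e + s2 *\<^sub>R v + s2' *\<^sub>R u)"
    using t by simp
  moreover have "dist (F u v (e + s1 *\<^sub>R u + s1' *\<^sub>R v)) (F u v e) < \<epsilon>"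
    using small[OF 1] by (intro d1) (simp add: d_def)
  moreover have "dist (F v u (e + s2 *\<^sub>R v + s2' *\<^sub>R u)) (F v u e) < \<epsilon>"
    using small[of s2' s2] 2 by (intro d2) (simp add: d_def swap)
  ultimately show False unfolding \<epsilon>_def dist_real_def by argo
qed

section \<open>Commutators of the adapted frame\<close>

lemma lie_unique: "(f has_derivative f') (at e) \<Longrightarrow> lie Z f e = f' (Z e)"
  by (simp add: lie_def frechet_derivative_at[symmetric])

lemma lie_const: "lie Z (\<lambda>y. c) e = 0"
  by (simp add: lie_def)

lemmas frechet_derivative_worksD = frechet_derivative_works[THEN iffD1]

lemma lie_add:
  "f differentiable at e \<Longrightarrow> g differentiable at e \<Longrightarrow>
    lie Z (\<lambda>y. f y + g y) e = lie Z f e + lie Z g e"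
  using lie_unique[OF has_derivative_add[OF frechet_derivative_worksD frechet_derivative_worksD]]
  by (simp add: lie_def)

lemma lie_diff:
  "f differentiable at e \<Longrightarrow> g differentiable at e \<Longrightarrow>
    lie Z (\<lambda>y. f y - g y) e = lie Z f e - lie Z g e"
  using lie_unique[OF has_derivative_diff[OF frechet_derivative_worksD frechet_derivative_worksD]]
  by (simp add: lie_def)

lemma lie_mult:
  "f differentiable at e \<Longrightarrow> g differentiable at e \<Longrightarrow>
    lie Z (\<lambda>y. f y * g y) e = f e * lie Z g e + lie Z f e * g e"
  using lie_unique[OF has_derivative_mult[OF frechet_derivative_worksD frechet_derivative_worksD]]
  by (simp add: lie_def)

lemma lie_sum:
  assumes "\<And>i. i \<in> I \<Longrightarrow> f i differentiable at e"
  shows "lie Z (\<lambda>y. \<Sum>i\<in>I. f i y) e = (\<Sum>i\<in>I. lie Z (f i) e)"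
  using lie_unique[OF has_derivative_sum[OF frechet_derivative_worksD[OF assms]]] by (simp add: lie_def)

lemma differentiable_cong_open:
  assumes "open S" and "e \<in> S" and "\<And>y. y \<in> S \<Longrightarrow> f y = g y" and "f differentiable at e"
  shows "g differentiable at e"
  using has_derivative_transform_within_open[OF frechet_derivative_worksD[OF assms(4)] assms(1,2,3)]
  by (rule differentiableI)

lemma lie_cong:
  assumes "open S" and "e \<in> S" and "\<And>y. y \<in> S \<Longrightarrow> f y = g y" and "f differentiable at e"
  shows "lie Z f e = lie Z g e"
  unfolding lie_def using frechet_derivative_transform_within_open[OF assms(4,1,2,3)] by simp

text \<open>\<open>Z\<close> is expanded in the standard basis because \<open>Ck_on\<close> only speaks of derivatives in fixed
  directions.\<close>

lemma lie_has_derivative: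
  fixes f :: "('m::finite, 'n::finite) jet \<Rightarrow> real"
  assumes S: "open S" "e \<in> S" and f: "Ck_on 2 S f" and Z: "(Z has_derivative Z') (at e)"
  shows "(lie Z f has_derivative (\<lambda>v. frechet_derivative f (at e) (Z' v)
    + frechet_derivative (\<lambda>y. frechet_derivative f (at y) v) (at e) (Z e))) (at e)"
proof -
  define d where "d b y = frechet_derivative f (at y) b" for b y
  have f2: "Ck_on (Suc (Suc 0)) S f" using f by (simp only: numeral_2_eq_2)
  then have "Ck_on (Suc 0) S (d b)" for b
    unfolding d_def[abs_def] Ck_on.simps(2)[of "Suc 0"] by blast
  then have dd: "d b differentiable at y" if "y \<in> S" for y b
    using that by (rule Ck_on_imp_differentiable)
  have fd: "f differentiable at y" if "y \<in> S" for y
    using f2 that by (rule Ck_on_imp_differentiable)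
  have lin: "linear (frechet_derivative f (at y))" if "y \<in> S" for y
    by (rule linear_frechet_derivative[OF fd[OF that]])
  have expand: "frechet_derivative f (at y) u = (\<Sum>b\<in>Basis. (u \<bullet> b) * d b y)" if "y \<in> S" for y u
  proof -
    have "frechet_derivative f (at y) (\<Sum>b\<in>Basis. (u \<bullet> b) *\<^sub>R b) = (\<Sum>b\<in>Basis. (u \<bullet> b) * d b y)"
      unfolding linear_sum[OF lin[OF that]] linear_cmul[OF lin[OF that]] d_def by (rule sum.cong) auto
    then show ?thesis unfolding euclidean_representation .
  qed
  have ld: "linear (frechet_derivative (d v) (at e))" for v
    by (rule linear_frechet_derivative[OF dd[OF S(2)]])
  \<comment> \<open>Differentiating the expanded \<open>lie Z f\<close> along \<open>v\<close>
    produces derivatives taken along \<open>b\<close> first and \<open>v\<close> second. The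
    symmetry of mixed derivatives turns them into the derivative of \<open>d v\<close> along
    \<open>Z e\<close>, which is again free of the basis.\<close>
  have second: "frechet_derivative (d v) (at e) u = (\<Sum>b\<in>Basis. (u \<bullet> b) * frechet_derivative (d b) (at e) v)"
    for u v
  proof -
    have "frechet_derivative (d v) (at e) (\<Sum>b\<in>Basis. (u \<bullet> b) *\<^sub>R b) =
        (\<Sum>b\<in>Basis. (u \<bullet> b) * frechet_derivative (d v) (at e) b)"
      unfolding linear_sum[OF ld] linear_cmul[OF ld] by (rule sum.cong) auto
    also have "\<dots> = (\<Sum>b\<in>Basis. (u \<bullet> b) * frechet_derivative (d b) (at e) v)"
      unfolding d_def[abs_def] by (intro sum.cong refl arg_cong2[where f = "(*)"] mixed_derivatives_commute[OF S f])
    finally show ?thesis unfolding euclidean_representation .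
  qed
  have "((\<lambda>y. \<Sum>b\<in>Basis. (Z y \<bullet> b) * d b y) has_derivative
      (\<lambda>v. \<Sum>b\<in>Basis. (Z e \<bullet> b) * frechet_derivative (d b) (at e) v + (Z' v \<bullet> b) * d b e)) (at e)"
    by (intro has_derivative_sum has_derivative_mult has_derivative_inner_left Z)
      (use dd[OF S(2)] in \<open>simp add: frechet_derivative_works\<close>)
  then have "((\<lambda>y. \<Sum>b\<in>Basis. (Z y \<bullet> b) * d b y) has_derivative
      (\<lambda>v. frechet_derivative f (at e) (Z' v) + frechet_derivative (d v) (at e) (Z e))) (at e)"
    by (rule has_derivative_eq_rhs) (simp only: second[where u = "Z e"] expand[OF S(2)] sum.distrib add.commute)
  then show ?thesis
    unfolding d_def[abs_def]
  proof (rule has_derivative_transform_within_open[OF _ S])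
    show "(\<Sum>b\<in>Basis. (Z y \<bullet> b) * frechet_derivative f (at y) b) = lie Z f y" if "y \<in> S" for y
      unfolding lie_def expand[OF that, of "Z y"] by (simp only: d_def)
  qed
qed

text \<open>The vector \<open>Z' (W e) - W' (Z e)\<close> is the Lie bracket [W, Z] at
  \<open>e\<close>; the second-order terms cancel by symmetry.\<close>

lemma lie_commutator:
  fixes f :: "('m::finite, 'n::finite) jet \<Rightarrow> real"
  assumes S: "open S" "e \<in> S" and f: "Ck_on 2 S f"
    and Z: "(Z has_derivative Z') (at e)" and W: "(W has_derivative W') (at e)"
  shows "lie W (lie Z f) e - lie Z (lie W f) e = frechet_derivative f (at e) (Z' (W e) - W' (Z e))"
proof -
  have "f differentiable at e" by (rule Ck_on_imp_differentiable[OF f[unfolded numeral_2_eq_2] S(2)])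
  then have "linear (frechet_derivative f (at e))" by (rule linear_frechet_derivative)
  from linear_diff[OF this, of "Z' (W e)" "W' (Z e)"]
  show ?thesis
    using lie_unique[OF lie_has_derivative[OF S f Z], of W] lie_unique[OF lie_has_derivative[OF S f W], of Z]
      mixed_derivatives_commute[OF S f, of "W e" "Z e"]
    by argo
qed

text \<open>With the three cases merged, every frame field is a constant field minus a combination
  of the \<open>part_p r s\<close>, so one formula covers all brackets.\<close>

primrec ncoef :: "('m::finite, 'n::finite) nlc \<Rightarrow> ('m, 'n) index \<Rightarrow> 'n \<Rightarrow> 'm \<Rightarrow> ('m, 'n) jet \<Rightarrow> real" where
  "ncoef N (Ti a) r f = N_T N r f a"
| "ncoef N (Mi i) r f = N_M N r f i"
| "ncoef N (Vi i a) r f = (\<lambda>e. 0)"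

primrec coord :: "('m::finite, 'n::finite) index \<Rightarrow> ('m, 'n) jet" where
  "coord (Ti a) = (axis a 1, 0, 0)"
| "coord (Mi i) = (0, axis i 1, 0)"
| "coord (Vi i a) = (0, 0, axis i (axis a 1))"

lemma axis_sum_fibre:
  fixes u :: "'n::finite \<Rightarrow> 'm::finite \<Rightarrow> real"
  shows "(\<Sum>r\<in>UNIV. \<Sum>s\<in>UNIV. u r s *\<^sub>R axis r (axis s (1::real))) = (\<chi> r s. u r s)"
proof -
  have "(\<Sum>s\<in>UNIV. u r s *\<^sub>R (axis r (axis s (1::real)) :: real^'m^'n) $ j $ b) = (if r = j then u r b else 0)"
    for r j b
    by (simp add: axis_def if_distrib cong: if_cong)
  then show ?thesis by (simp add: vec_eq_iff)
qed

lemma frame_expand: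
  "frame N z e = coord z - (\<Sum>r\<in>UNIV. \<Sum>s\<in>UNIV. ncoef N z r s e *\<^sub>R part_p r s e)"
proof -
  have "(\<Sum>r\<in>UNIV. \<Sum>s\<in>UNIV. u r s *\<^sub>R part_p r s e) = (0, 0, \<chi> r s. u r s)"
    for u :: "'b \<Rightarrow> 'a \<Rightarrow> real"
    by (simp add: part_p_def prod_eq_iff fst_sum snd_sum flip: axis_sum_fibre)
  moreover have "frame N z e = coord z - (0, 0, \<chi> r s. ncoef N z r s e)"
    by (cases z) (simp_all add: delta_t_def delta_x_def part_p_def vec_eq_iff)
  ultimately show ?thesis by simp
qed

lemma frame_has_derivative:
  assumes "\<And>r s. ncoef N z r s differentiable at e"
  shows "(frame N z has_derivative (\<lambda>v. - (\<Sum>r\<in>UNIV. \<Sum>s\<in>UNIV.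
    frechet_derivative (ncoef N z r s) (at e) v *\<^sub>R part_p r s e))) (at e)"
proof -
  have "((\<lambda>y. coord z - (\<Sum>r\<in>UNIV. \<Sum>s\<in>UNIV. ncoef N z r s y *\<^sub>R (0, 0, axis r (axis s (1::real))))) has_derivative
    (\<lambda>v. 0 - (\<Sum>r\<in>UNIV. \<Sum>s\<in>UNIV. frechet_derivative (ncoef N z r s) (at e) v *\<^sub>R (0, 0, axis r (axis s (1::real)))))) (at e)"
    by (intro has_derivative_diff has_derivative_const has_derivative_sum has_derivative_scaleR_left)
      (use assms in \<open>simp add: frechet_derivative_works\<close>)
  moreover have "frame N z = (\<lambda>y. coord z - (\<Sum>r\<in>UNIV. \<Sum>s\<in>UNIV. ncoef N z r s y *\<^sub>R (0, 0, axis r (axis s (1::real)))))"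
    by (simp add: fun_eq_iff frame_expand part_p_def)
  ultimately show ?thesis by (simp add: part_p_def)
qed

text \<open>The vertical components of the Lie bracket of \<open>frame N z\<close> and
  \<open>frame N w\<close>, in this order. For two horizontal directions they are the d-tensors R;
  for a horizontal \<open>z\<close> and a vertical \<open>w\<close> they are the part of P that
  differentiates N.\<close>

definition bracket :: "('m::finite, 'n::finite) nlc \<Rightarrow> ('m, 'n) index \<Rightarrow> ('m, 'n) index \<Rightarrow>
    'n \<Rightarrow> 'm \<Rightarrow> ('m, 'n) jet \<Rightarrow> real" where
  "bracket N z w r s e = lie (frame N w) (ncoef N z r s) e - lie (frame N z) (ncoef N w r s) e"

lemma frame_commutator:
  assumes S: "open S" "e \<in> S" and f: "Ck_on 2 S f"
    and N: "\<And>z r s. ncoef N z r s differentiable at e"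
  shows "lie (frame N w) (lie (frame N z) f) e - lie (frame N z) (lie (frame N w) f) e =
    - (\<Sum>r\<in>UNIV. \<Sum>s\<in>UNIV. bracket N z w r s e * lie (part_p r s) f e)"
proof -
  have "f differentiable at e" by (rule Ck_on_imp_differentiable[OF f[unfolded numeral_2_eq_2] S(2)])
  then have lin: "linear (frechet_derivative f (at e))" by (rule linear_frechet_derivative)
  have df: "(frame N z has_derivative (\<lambda>v. - (\<Sum>r\<in>UNIV. \<Sum>s\<in>UNIV.
      frechet_derivative (ncoef N z r s) (at e) v *\<^sub>R part_p r s e))) (at e)" for z
    by (rule frame_has_derivative[OF N])
  show ?thesis
    by (subst lie_commutator[OF S f df[of z] df[of w]], simp only: linear_diff[OF lin] linear_neg[OF lin] linear_sum[OF lin] linear_cmul[OF lin])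
     (simp add: bracket_def lie_def left_diff_distrib sum_subtractf)
qed

lemma smooth_on_frame:
  assumes "open S" and "\<And>r s. smooth_on S (ncoef N z r s)"
  shows "smooth_on S (frame N z)"
proof -
  \<comment> \<open>The minus sign sits on the constant vector, so that closure under sums and
    bilinear products suffices.\<close>
  have "frame N z = (\<lambda>y. coord z + (\<Sum>r\<in>UNIV. \<Sum>s\<in>UNIV. ncoef N z r s y *\<^sub>R (0, 0, - axis r (axis s (1::real)))))"
    by (simp add: fun_eq_iff frame_expand part_p_def prod_eq_iff fst_sum snd_sum sum_negf)
  moreover have "smooth_on S \<dots>"
    by (intro smooth_on_add smooth_on_const smooth_on_sum assms
        smooth_on_bilinear[OF bounded_bilinear_scaleR])
  ultimately show ?thesis by simp
qed

section \<open>The Ricci identity in the adapted frame\<close>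

lemma UNIV_index:
  "(UNIV :: ('m, 'n) index set) = range Ti \<union> (range Mi \<union> (\<lambda>(r, s). Vi r s) ` (UNIV \<times> UNIV))"
  by (auto simp: image_iff) (metis index.exhaust)

lemma sum_index:
  fixes F :: "('m::finite, 'n::finite) index \<Rightarrow> real"
  shows "(\<Sum>\<zeta>\<in>UNIV. F \<zeta>) =
    (\<Sum>a\<in>UNIV. F (Ti a)) + (\<Sum>i\<in>UNIV. F (Mi i)) + (\<Sum>r\<in>UNIV. \<Sum>s\<in>UNIV. F (Vi r s))"
proof -
  have "(\<Sum>\<zeta>\<in>UNIV. F \<zeta>) = sum F (range Ti) + (sum F (range Mi) + sum F ((\<lambda>(r, s). Vi r s) ` (UNIV \<times> UNIV)))"
    unfolding UNIV_index by (subst sum.union_disjoint sum.union_disjoint, auto)+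
  also have "sum F (range Ti) = (\<Sum>a\<in>UNIV. F (Ti a))"
    by (subst sum.reindex) (auto simp: inj_on_def)
  also have "sum F (range Mi) = (\<Sum>i\<in>UNIV. F (Mi i))"
    by (subst sum.reindex) (auto simp: inj_on_def)
  also have "sum F ((\<lambda>(r, s). Vi r s) ` (UNIV \<times> UNIV)) = (\<Sum>r\<in>UNIV. \<Sum>s\<in>UNIV. F (Vi r s))"
    by (subst sum.reindex) (auto simp: inj_on_def sum.cartesian_product split_def)
  finally show ?thesis by simp
qed

lemma finite_UNIV_index: "finite (UNIV :: ('m::finite, 'n::finite) index set)"
  unfolding UNIV_index by (intro finite_UnI finite_imageI finite_cartesian_product finite)

text \<open>The sign in front of \<open>conn_V\<close> makes \<open>conn \<Gamma> z \<alpha> \<beta>\<close> the coefficient of the \<open>\<alpha>\<close>-th frame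
  field in the covariant derivative of the \<open>\<beta>\<close>-th one along the \<open>z\<close>-th one.\<close>

fun conn :: "('m::finite, 'n::finite) components \<Rightarrow> ('m, 'n) index \<Rightarrow> ('m, 'n) index \<Rightarrow>
    ('m, 'n) index \<Rightarrow> ('m, 'n) jet \<Rightarrow> real" where
  "conn \<Gamma> z (Ti a) (Ti b) = conn_T \<Gamma> z a b"
| "conn \<Gamma> z (Mi i) (Mi j) = conn_M \<Gamma> z i j"
| "conn \<Gamma> z (Vi i a) (Vi j b) = (\<lambda>e. - conn_V \<Gamma> z i a b j e)"
| "conn \<Gamma> z _ _ = (\<lambda>e. 0)"

text \<open>The cases of a slot collapse to one sum over all frame indices: the off-diagonal blocks
  of \<open>conn\<close> vanish, and its sign on the vertical block absorbs the one in
  \<open>slot_term\<close>.\<close>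

lemma slot_term_Up:
  assumes "is ! q = Up \<alpha>"
  shows "slot_term \<Gamma> z T is q e = (\<Sum>\<beta>\<in>UNIV. T (is[q := Up \<beta>]) e * conn \<Gamma> z \<alpha> \<beta> e)"
  using assms by (cases \<alpha>) (simp_all add: slot_term_def sum_index sum_negf)

lemma slot_term_Dn:
  assumes "is ! q = Dn \<alpha>"
  shows "slot_term \<Gamma> z T is q e = - (\<Sum>\<beta>\<in>UNIV. T (is[q := Dn \<beta>]) e * conn \<Gamma> z \<beta> \<alpha> e)"
  using assms by (cases \<alpha>) (simp_all add: slot_term_def sum_index sum_negf)

lemma nabla_vector:
  "nabla N \<Gamma> T [Up \<alpha>, Dn z] e =
    lie (frame N z) (T [Up \<alpha>]) e + (\<Sum>\<beta>\<in>UNIV. T [Up \<beta>] e * conn \<Gamma> z \<alpha> \<beta> e)"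
  by (simp add: nabla_def slot_term_Up)

text \<open>The last sum is there because the index of the first derivative counts as a tensor
  index. Antisymmetrized in \<open>z\<close> and \<open>w\<close>, it becomes the connection part of
  the torsion.\<close>

lemma nabla_vector_covector:
  "nabla N \<Gamma> T [Up \<alpha>, Dn z, Dn w] e =
    lie (frame N w) (T [Up \<alpha>, Dn z]) e + (\<Sum>\<beta>\<in>UNIV. T [Up \<beta>, Dn z] e * conn \<Gamma> w \<alpha> \<beta> e)
    - (\<Sum>\<zeta>\<in>UNIV. T [Up \<alpha>, Dn \<zeta>] e * conn \<Gamma> w \<zeta> z e)"
  by (simp add: nabla_def slot_term_Up slot_term_Dn lessThan_Suc numeral_2_eq_2)

text \<open>The component along the \<alpha>-th frame field of R(\<open>frame N w\<close>,
  \<open>frame N z\<close>) applied to the \<beta>-th one. The last sum is minus the covariant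
  derivative along the bracket of these two fields.\<close>

definition curvature :: "('m::finite, 'n::finite) nlc \<Rightarrow> ('m, 'n) components \<Rightarrow> ('m, 'n) index \<Rightarrow>
    ('m, 'n) index \<Rightarrow> ('m, 'n) index \<Rightarrow> ('m, 'n) index \<Rightarrow> ('m, 'n) jet \<Rightarrow> real" where
  "curvature N \<Gamma> z w \<alpha> \<beta> e = lie (frame N w) (conn \<Gamma> z \<alpha> \<beta>) e - lie (frame N z) (conn \<Gamma> w \<alpha> \<beta>) e
    + (\<Sum>\<gamma>\<in>UNIV. conn \<Gamma> z \<gamma> \<beta> e * conn \<Gamma> w \<alpha> \<gamma> e) - (\<Sum>\<gamma>\<in>UNIV. conn \<Gamma> w \<gamma> \<beta> e * conn \<Gamma> z \<alpha> \<gamma> e)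
    + (\<Sum>r\<in>UNIV. \<Sum>s\<in>UNIV. conn \<Gamma> (Vi r s) \<alpha> \<beta> e * bracket N z w r s e)"

text \<open>The \<zeta>-component of the torsion of \<open>frame N w\<close> and
  \<open>frame N z\<close>, in the same order of directions as in \<open>curvature\<close>.\<close>

definition torsion :: "('m::finite, 'n::finite) nlc \<Rightarrow> ('m, 'n) components \<Rightarrow> ('m, 'n) index \<Rightarrow>
    ('m, 'n) index \<Rightarrow> ('m, 'n) index \<Rightarrow> ('m, 'n) jet \<Rightarrow> real" where
  "torsion N \<Gamma> z w \<zeta> e = conn \<Gamma> w \<zeta> z e - conn \<Gamma> z \<zeta> w e
    + (case \<zeta> of Vi r s \<Rightarrow> bracket N z w r s e | _ \<Rightarrow> 0)"

lemma Ricci_identity: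
  assumes S: "open S" "e \<in> S" and T: "\<And>\<alpha>. Ck_on 2 S (T [Up \<alpha>])"
    and N: "\<And>z r s. ncoef N z r s differentiable at e"
    and \<Gamma>: "\<And>z \<alpha> \<beta>. conn \<Gamma> z \<alpha> \<beta> differentiable at e"
  shows "nabla N \<Gamma> (nabla N \<Gamma> T) [Up \<alpha>, Dn z, Dn w] e - nabla N \<Gamma> (nabla N \<Gamma> T) [Up \<alpha>, Dn w, Dn z] e =
    (\<Sum>\<beta>\<in>UNIV. T [Up \<beta>] e * curvature N \<Gamma> z w \<alpha> \<beta> e)
    - (\<Sum>\<zeta>\<in>UNIV. nabla N \<Gamma> T [Up \<alpha>, Dn \<zeta>] e * torsion N \<Gamma> z w \<zeta> e)"
proof -
  have T1: "T [Up \<alpha>] differentiable at e" for \<alpha>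
    by (rule Ck_on_imp_differentiable[OF T[unfolded numeral_2_eq_2] S(2)])
  have T2: "lie (frame N z) (T [Up \<alpha>]) differentiable at e" for z \<alpha>
    using lie_has_derivative[OF S T frame_has_derivative[OF N]] by (rule differentiableI)
  define t where "t \<beta> = T [Up \<beta>] e" for \<beta>
  define G where "G z \<alpha> \<beta> = conn \<Gamma> z \<alpha> \<beta> e" for z \<alpha> \<beta>
  define L where "L z w = lie (frame N w) (lie (frame N z) (T [Up \<alpha>])) e" for z w
  \<comment> \<open>This local \<open>dt\<close> is a frame derivative of a component and hides the
    one-form of that name.\<close>
  define dt where "dt z \<beta> = lie (frame N z) (T [Up \<beta>]) e" for z \<beta>
  define dG where "dG w z \<beta> = lie (frame N w) (conn \<Gamma> z \<alpha> \<beta>) e" for w z \<beta>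
  define M where "M z \<beta> = nabla N \<Gamma> T [Up \<beta>, Dn z] e" for z \<beta>
  define B where "B = bracket N z w"
  have M: "M z \<beta> = dt z \<beta> + (\<Sum>\<gamma>\<in>UNIV. t \<gamma> * G z \<beta> \<gamma>)" for z \<beta>
    by (simp add: M_def dt_def t_def G_def nabla_vector)
  have "lie (frame N w) (nabla N \<Gamma> T [Up \<alpha>, Dn z]) e =
      L z w + (\<Sum>\<beta>\<in>UNIV. t \<beta> * dG w z \<beta> + dt w \<beta> * G z \<alpha> \<beta>)" for z w
  proof -
    have "nabla N \<Gamma> T [Up \<alpha>, Dn z] =
        (\<lambda>e. lie (frame N z) (T [Up \<alpha>]) e + (\<Sum>\<beta>\<in>UNIV. T [Up \<beta>] e * conn \<Gamma> z \<alpha> \<beta> e))"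
      by (rule ext) (rule nabla_vector)
    then show ?thesis
      by (simp add: lie_add lie_sum lie_mult T1 T2 \<Gamma> finite_UNIV_index
          differentiable_sum differentiable_mult L_def t_def dG_def dt_def G_def)
  qed
  then have second: "nabla N \<Gamma> (nabla N \<Gamma> T) [Up \<alpha>, Dn z, Dn w] e =
      L z w + (\<Sum>\<beta>\<in>UNIV. t \<beta> * dG w z \<beta> + dt w \<beta> * G z \<alpha> \<beta>)
      + (\<Sum>\<beta>\<in>UNIV. M z \<beta> * G w \<alpha> \<beta>) - (\<Sum>\<zeta>\<in>UNIV. M \<zeta> \<alpha> * G w \<zeta> z)" for z w
    by (simp add: nabla_vector_covector M_def G_def)
  \<comment> \<open>The sum with \<open>dt z \<beta> * G w \<alpha> \<beta>\<close> joins the one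
    with \<open>dt w \<beta> * G z \<alpha> \<beta>\<close> from \<open>second\<close>. Together
    they are symmetric in \<open>z\<close> and \<open>w\<close> and drop out of the
    commutator.\<close>
  have prod: "(\<Sum>\<beta>\<in>UNIV. M z \<beta> * G w \<alpha> \<beta>) =
      (\<Sum>\<beta>\<in>UNIV. dt z \<beta> * G w \<alpha> \<beta>) + (\<Sum>\<beta>\<in>UNIV. t \<beta> * (\<Sum>\<gamma>\<in>UNIV. G z \<gamma> \<beta> * G w \<alpha> \<gamma>))" for z w
  proof -
    have "(\<Sum>\<beta>\<in>UNIV. (\<Sum>\<gamma>\<in>UNIV. t \<gamma> * G z \<beta> \<gamma>) * G w \<alpha> \<beta>) =
        (\<Sum>\<beta>\<in>UNIV. \<Sum>\<gamma>\<in>UNIV. t \<gamma> * (G z \<beta> \<gamma> * G w \<alpha> \<beta>))"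
      by (simp add: sum_distrib_right mult.assoc)
    also have "\<dots> = (\<Sum>\<gamma>\<in>UNIV. \<Sum>\<beta>\<in>UNIV. t \<gamma> * (G z \<beta> \<gamma> * G w \<alpha> \<beta>))"
      by (rule sum.swap)
    finally show ?thesis by (simp add: M distrib_right sum.distrib sum_distrib_left)
  qed
  have comm: "L z w - L w z = - (\<Sum>r\<in>UNIV. \<Sum>s\<in>UNIV. B r s e * dt (Vi r s) \<alpha>)"
    unfolding L_def frame_commutator[OF S T N] by (simp add: B_def dt_def)
  have vert: "(\<Sum>r\<in>UNIV. \<Sum>s\<in>UNIV. B r s e * dt (Vi r s) \<alpha>) =
      (\<Sum>r\<in>UNIV. \<Sum>s\<in>UNIV. M (Vi r s) \<alpha> * B r s e)
      - (\<Sum>\<beta>\<in>UNIV. t \<beta> * (\<Sum>r\<in>UNIV. \<Sum>s\<in>UNIV. G (Vi r s) \<alpha> \<beta> * B r s e))"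
  proof -
    have "(\<Sum>\<beta>\<in>UNIV. t \<beta> * (\<Sum>r\<in>UNIV. \<Sum>s\<in>UNIV. G (Vi r s) \<alpha> \<beta> * B r s e)) =
        (\<Sum>\<beta>\<in>UNIV. \<Sum>r\<in>UNIV. \<Sum>s\<in>UNIV. t \<beta> * G (Vi r s) \<alpha> \<beta> * B r s e)"
      by (simp add: sum_distrib_left mult.assoc)
    also have "\<dots> = (\<Sum>r\<in>UNIV. \<Sum>\<beta>\<in>UNIV. \<Sum>s\<in>UNIV. t \<beta> * G (Vi r s) \<alpha> \<beta> * B r s e)"
      by (rule sum.swap)
    also have "\<dots> = (\<Sum>r\<in>UNIV. \<Sum>s\<in>UNIV. \<Sum>\<beta>\<in>UNIV. t \<beta> * G (Vi r s) \<alpha> \<beta> * B r s e)"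
      by (intro sum.cong refl sum.swap)
    also have "\<dots> = (\<Sum>r\<in>UNIV. \<Sum>s\<in>UNIV. M (Vi r s) \<alpha> * B r s e - B r s e * dt (Vi r s) \<alpha>)"
      by (simp add: M algebra_simps sum_distrib_left)
    finally show ?thesis by (simp add: sum_subtractf)
  qed
  have tors: "(\<Sum>\<zeta>\<in>UNIV. M \<zeta> \<alpha> * torsion N \<Gamma> z w \<zeta> e) =
      (\<Sum>\<zeta>\<in>UNIV. M \<zeta> \<alpha> * G w \<zeta> z) - (\<Sum>\<zeta>\<in>UNIV. M \<zeta> \<alpha> * G z \<zeta> w)
      + (\<Sum>r\<in>UNIV. \<Sum>s\<in>UNIV. M (Vi r s) \<alpha> * B r s e)"
  proof -
    have "(\<Sum>\<zeta>\<in>UNIV. M \<zeta> \<alpha> * (case \<zeta> of Vi r s \<Rightarrow> B r s e | _ \<Rightarrow> 0)) =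
        (\<Sum>r\<in>UNIV. \<Sum>s\<in>UNIV. M (Vi r s) \<alpha> * B r s e)"
      by (simp add: sum_index)
    then show ?thesis
      unfolding torsion_def B_def[symmetric]
      by (simp add: G_def distrib_left right_diff_distrib sum.distrib sum_subtractf)
  qed
  have curv: "(\<Sum>\<beta>\<in>UNIV. t \<beta> * curvature N \<Gamma> z w \<alpha> \<beta> e) =
      (\<Sum>\<beta>\<in>UNIV. t \<beta> * dG w z \<beta>) - (\<Sum>\<beta>\<in>UNIV. t \<beta> * dG z w \<beta>)
      + (\<Sum>\<beta>\<in>UNIV. t \<beta> * (\<Sum>\<gamma>\<in>UNIV. G z \<gamma> \<beta> * G w \<alpha> \<gamma>))
      - (\<Sum>\<beta>\<in>UNIV. t \<beta> * (\<Sum>\<gamma>\<in>UNIV. G w \<gamma> \<beta> * G z \<alpha> \<gamma>))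
      + (\<Sum>\<beta>\<in>UNIV. t \<beta> * (\<Sum>r\<in>UNIV. \<Sum>s\<in>UNIV. G (Vi r s) \<alpha> \<beta> * B r s e))"
    by (simp add: curvature_def G_def dG_def B_def distrib_left right_diff_distrib sum.distrib sum_subtractf)
  have "nabla N \<Gamma> (nabla N \<Gamma> T) [Up \<alpha>, Dn z, Dn w] e - nabla N \<Gamma> (nabla N \<Gamma> T) [Up \<alpha>, Dn w, Dn z] e =
      (\<Sum>\<beta>\<in>UNIV. t \<beta> * curvature N \<Gamma> z w \<alpha> \<beta> e) - (\<Sum>\<zeta>\<in>UNIV. M \<zeta> \<alpha> * torsion N \<Gamma> z w \<zeta> e)"
    unfolding second prod sum.distrib curv tors using comm vert by linarith
  then show ?thesis by (simp add: t_def M_def)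
qed

section \<open>Curvature and torsion of an \<open>h\<close>-normal connection\<close>

lemma sum_of_bool_mult:
  fixes F :: "'k::finite \<Rightarrow> real"
  shows "(\<Sum>r\<in>UNIV. of_bool (r = j) * F r) = F j" "(\<Sum>r\<in>UNIV. of_bool (j = r) * F r) = F j"
  by (simp_all add: of_bool_def if_distrib[where f = "\<lambda>x. x * _"] cong: if_cong)

text \<open>This is the chain rule along the straight line through \<open>e\<close>. It is meant for
  Christoffel symbols, whose differentiability is obtained below as functions on jets; restricting
  to a line avoids factoring them through \<open>fst\<close>.\<close>

lemma lie_const_direction:
  assumes f: "f differentiable at e" and const: "\<And>t::real. f (e + t *\<^sub>R Z e) = f e"
  shows "lie Z f e = (0::real)"
proof -
  have "((\<lambda>t::real. e + t *\<^sub>R Z e) has_derivative (\<lambda>t. t *\<^sub>R Z e)) (at 0)"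
    by (auto intro!: derivative_eq_intros)
  moreover have "(f has_derivative frechet_derivative f (at e)) (at (e + (0::real) *\<^sub>R Z e))"
    using f by (simp add: frechet_derivative_works)
  ultimately have "((\<lambda>t::real. f (e + t *\<^sub>R Z e)) has_derivative (\<lambda>t. frechet_derivative f (at e) (t *\<^sub>R Z e))) (at 0)"
    by (rule has_derivative_compose)
  then have "((\<lambda>t::real. f e) has_derivative (\<lambda>t. frechet_derivative f (at e) (t *\<^sub>R Z e))) (at 0)"
    by (simp add: const)
  from has_derivative_unique[OF this has_derivative_const] have "frechet_derivative f (at e) (1 *\<^sub>R Z e) = 0"
    by meson
  then show ?thesis by (simp add: lie_def)
qed

lemma nabla_C_tensor:
  "nabla N \<Gamma> (C_tensor \<Gamma>) [Up (Mi l), Dn (Mi i), Dn (Vi k c), Dn z] e =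
    lie (frame N z) (C_M \<Gamma> l i k c) e
    + (\<Sum>r\<in>UNIV. C_M \<Gamma> r i k c e * conn_M \<Gamma> z l r e)
    - (\<Sum>r\<in>UNIV. C_M \<Gamma> l r k c e * conn_M \<Gamma> z r i e)
    + (\<Sum>r\<in>UNIV. \<Sum>f\<in>UNIV. C_M \<Gamma> l i r f e * conn_V \<Gamma> z r f c k e)"
proof -
  have "C_tensor \<Gamma> [Up (Mi l), Dn (Mi i), Dn (Vi k c)] = C_M \<Gamma> l i k c"
    by (simp add: fun_eq_iff C_tensor_def)
  then show ?thesis
    by (simp add: nabla_def slot_term_def lessThan_Suc C_tensor_def numeral_3_eq_3)
qed

definition curvature_T :: "('m::finite, 'n::finite) nlc \<Rightarrow> ('m, 'n) components \<Rightarrow> ('m, 'n) index \<Rightarrow>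
    ('m, 'n) index \<Rightarrow> 'm \<Rightarrow> 'm \<Rightarrow> ('m, 'n) jet \<Rightarrow> real" where
  "curvature_T N \<Gamma> z w a b = curvature N \<Gamma> z w (Ti a) (Ti b)"

definition curvature_M :: "('m::finite, 'n::finite) nlc \<Rightarrow> ('m, 'n) components \<Rightarrow> ('m, 'n) index \<Rightarrow>
    ('m, 'n) index \<Rightarrow> 'n \<Rightarrow> 'n \<Rightarrow> ('m, 'n) jet \<Rightarrow> real" where
  "curvature_M N \<Gamma> z w i j = curvature N \<Gamma> z w (Mi i) (Mi j)"

lemma curvature_T_eq:
  "curvature_T N \<Gamma> z w a b e = lie (frame N w) (conn_T \<Gamma> z a b) e - lie (frame N z) (conn_T \<Gamma> w a b) e
    + (\<Sum>d\<in>UNIV. conn_T \<Gamma> z d b e * conn_T \<Gamma> w a d e) - (\<Sum>d\<in>UNIV. conn_T \<Gamma> w d b e * conn_T \<Gamma> z a d e)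
    + (\<Sum>r\<in>UNIV. \<Sum>s\<in>UNIV. conn_T \<Gamma> (Vi r s) a b e * bracket N z w r s e)"
  unfolding curvature_T_def curvature_def by (simp add: sum_index)

lemma curvature_M_eq:
  "curvature_M N \<Gamma> z w i j e = lie (frame N w) (conn_M \<Gamma> z i j) e - lie (frame N z) (conn_M \<Gamma> w i j) e
    + (\<Sum>l\<in>UNIV. conn_M \<Gamma> z l j e * conn_M \<Gamma> w i l e) - (\<Sum>l\<in>UNIV. conn_M \<Gamma> w l j e * conn_M \<Gamma> z i l e)
    + (\<Sum>r\<in>UNIV. \<Sum>s\<in>UNIV. conn_M \<Gamma> (Vi r s) i j e * bracket N z w r s e)"
  unfolding curvature_M_def curvature_def by (simp add: sum_index)

lemma curvature_off_diagonal:
  "curvature N \<Gamma> z w (Ti a) (Mi j) e = 0" "curvature N \<Gamma> z w (Ti a) (Vi j b) e = 0"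
  "curvature N \<Gamma> z w (Mi i) (Ti b) e = 0" "curvature N \<Gamma> z w (Mi i) (Vi j b) e = 0"
  "curvature N \<Gamma> z w (Vi i a) (Ti b) e = 0" "curvature N \<Gamma> z w (Vi i a) (Mi j) e = 0"
  by (simp_all add: curvature_def sum_index lie_const)

text \<open>One chart, with the operator \<open>D\<close> replaced by its components and
  \<open>h\<close>-normality by equations between them. The equation for \<open>conn_V\<close> is
  the trace left by the parallelism of J.\<close>

locale h_normal_chart =
  fixes \<Omega> :: "('m::finite, 'n::finite) jet set"
    and N :: "('m, 'n) nlc" and \<Gamma> :: "('m, 'n) components" and g :: "'m \<Rightarrow> 'm \<Rightarrow> real^'m \<Rightarrow> real"
  assumes open_dom: "open \<Omega>"
    and ncoef_diff: "e \<in> \<Omega> \<Longrightarrow> ncoef N z r s differentiable at e"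
    and conn_T_diff: "e \<in> \<Omega> \<Longrightarrow> conn_T \<Gamma> z a b differentiable at e"
    and conn_M_diff: "e \<in> \<Omega> \<Longrightarrow> conn_M \<Gamma> z i j differentiable at e"
    and A_T: "e \<in> \<Omega> \<Longrightarrow> A_T \<Gamma> a b d e = chris g a b d e"
    and H_T: "e \<in> \<Omega> \<Longrightarrow> H_T \<Gamma> a b i e = 0"
    and C_T: "e \<in> \<Omega> \<Longrightarrow> C_T \<Gamma> a b i d e = 0"
    and conn_V: "e \<in> \<Omega> \<Longrightarrow> conn_V \<Gamma> z i a b j e =
      of_bool (a = b) * conn_M \<Gamma> z j i e - of_bool (i = j) * conn_T \<Gamma> z a b e"
    and chris_sym: "e \<in> \<Omega> \<Longrightarrow> chris g a b d e = chris g a d b e"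
    and H_M_sym: "e \<in> \<Omega> \<Longrightarrow> H_M \<Gamma> i j k e = H_M \<Gamma> i k j e"
begin

lemma conn_Vi:
  "e \<in> \<Omega> \<Longrightarrow> conn \<Gamma> z (Vi i a) (Vi j b) e =
    of_bool (i = j) * conn_T \<Gamma> z a b e - of_bool (a = b) * conn_M \<Gamma> z j i e"
  by (simp add: conn_V)

lemma conn_Vi_rhs_diff:
  "e \<in> \<Omega> \<Longrightarrow> (\<lambda>e. of_bool (i = j) * conn_T \<Gamma> z a b e - of_bool (a = b) * conn_M \<Gamma> z j i e) differentiable at e"
  by (intro differentiable_diff differentiable_mult differentiable_const conn_T_diff conn_M_diff)

text \<open>The vertical block is known in terms of \<open>conn_T\<close> and \<open>conn_M\<close>
  only on \<Omega>; openness is what transports differentiability.\<close>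

lemma conn_diff:
  assumes "e \<in> \<Omega>"
  shows "conn \<Gamma> z \<alpha> \<beta> differentiable at e"
proof -
  have "conn \<Gamma> z (Vi i a) (Vi j b) differentiable at e" for i a j b
    by (rule differentiable_cong_open[OF open_dom assms conn_Vi[symmetric] conn_Vi_rhs_diff[OF assms]])
  then show ?thesis
    by (cases \<alpha>; cases \<beta>) (auto simp: conn_T_diff[OF assms] conn_M_diff[OF assms])
qed

lemma lie_conn_Vi:
  assumes "e \<in> \<Omega>"
  shows "lie Z (conn \<Gamma> z (Vi i a) (Vi j b)) e =
    of_bool (i = j) * lie Z (conn_T \<Gamma> z a b) e - of_bool (a = b) * lie Z (conn_M \<Gamma> z j i) e"
proof -
  have "lie Z (conn \<Gamma> z (Vi i a) (Vi j b)) e =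
      lie Z (\<lambda>e. of_bool (i = j) * conn_T \<Gamma> z a b e - of_bool (a = b) * conn_M \<Gamma> z j i e) e"
    by (rule lie_cong[OF open_dom assms conn_Vi conn_diff[OF assms]])
  then show ?thesis
    by (simp add: lie_diff lie_mult lie_const conn_T_diff[OF assms] conn_M_diff[OF assms] differentiable_mult)
qed

text \<open>The vertical bundle carries the connection induced on the dual of the \<open>M\<close>-part tensored with
  the \<open>T\<close>-part; the mixed terms of the product of connection matrices are symmetric in the two
  directions and cancel.\<close>

lemma curvature_Vi:
  assumes "e \<in> \<Omega>"
  shows "curvature N \<Gamma> z w (Vi i a) (Vi j b) e =
    of_bool (i = j) * curvature_T N \<Gamma> z w a b e - of_bool (a = b) * curvature_M N \<Gamma> z w j i e"
proof -
  have prod: "(\<Sum>\<gamma>\<in>UNIV. conn \<Gamma> z \<gamma> (Vi j b) e * conn \<Gamma> w (Vi i a) \<gamma> e) =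
      of_bool (i = j) * (\<Sum>d\<in>UNIV. conn_T \<Gamma> z d b e * conn_T \<Gamma> w a d e)
      - conn_T \<Gamma> w a b e * conn_M \<Gamma> z j i e - conn_T \<Gamma> z a b e * conn_M \<Gamma> w j i e
      + of_bool (a = b) * (\<Sum>l\<in>UNIV. conn_M \<Gamma> w l i e * conn_M \<Gamma> z j l e)" for z w
  proof -
    have tt: "(\<Sum>r\<in>UNIV. \<Sum>s\<in>UNIV. of_bool (r = j) * conn_T \<Gamma> z s b e * (of_bool (i = r) * conn_T \<Gamma> w a s e)) =
        of_bool (i = j) * (\<Sum>d\<in>UNIV. conn_T \<Gamma> z d b e * conn_T \<Gamma> w a d e)" (is "?L = _")
    proof -
      have "?L = (\<Sum>r\<in>UNIV. of_bool (r = j) * (of_bool (i = r) * (\<Sum>s\<in>UNIV. conn_T \<Gamma> z s b e * conn_T \<Gamma> w a s e)))"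
        by (simp only: sum_distrib_left mult_ac)
      then show ?thesis unfolding sum_of_bool_mult .
    qed
    have tm: "(\<Sum>r\<in>UNIV. \<Sum>s\<in>UNIV. of_bool (r = j) * conn_T \<Gamma> z s b e * (of_bool (a = s) * conn_M \<Gamma> w r i e)) =
        conn_T \<Gamma> z a b e * conn_M \<Gamma> w j i e" (is "?L = _")
    proof -
      have "?L = (\<Sum>r\<in>UNIV. of_bool (r = j) * (\<Sum>s\<in>UNIV. of_bool (a = s) * (conn_T \<Gamma> z s b e * conn_M \<Gamma> w r i e)))"
        by (simp only: sum_distrib_left mult_ac)
      then show ?thesis unfolding sum_of_bool_mult .
    qed
    have mt: "(\<Sum>r\<in>UNIV. \<Sum>s\<in>UNIV. of_bool (s = b) * conn_M \<Gamma> z j r e * (of_bool (i = r) * conn_T \<Gamma> w a s e)) =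
        conn_T \<Gamma> w a b e * conn_M \<Gamma> z j i e" (is "?L = _")
    proof -
      have "?L = (\<Sum>r\<in>UNIV. of_bool (i = r) * (\<Sum>s\<in>UNIV. of_bool (s = b) * (conn_M \<Gamma> z j r e * conn_T \<Gamma> w a s e)))"
        by (simp only: sum_distrib_left mult_ac)
      then show ?thesis unfolding sum_of_bool_mult by (simp only: mult.commute)
    qed
    \<comment> \<open>Passing to the dual reverses the order of the \<open>conn_M\<close> factors.
      Hence the quadratic part of the M-curvature gets the same minus sign as its derivative
      part.\<close>
    have mm: "(\<Sum>r\<in>UNIV. \<Sum>s\<in>UNIV. of_bool (s = b) * conn_M \<Gamma> z j r e * (of_bool (a = s) * conn_M \<Gamma> w r i e)) =
        of_bool (a = b) * (\<Sum>l\<in>UNIV. conn_M \<Gamma> w l i e * conn_M \<Gamma> z j l e)" (is "?L = _")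
    proof -
      have "?L = (\<Sum>r\<in>UNIV. \<Sum>s\<in>UNIV. of_bool (s = b) * (of_bool (a = s) * (conn_M \<Gamma> w r i e * conn_M \<Gamma> z j r e)))"
        by (simp only: sum_distrib_left mult_ac)
      then show ?thesis unfolding sum_of_bool_mult sum_distrib_left .
    qed
    have "(\<Sum>\<gamma>\<in>UNIV. conn \<Gamma> z \<gamma> (Vi j b) e * conn \<Gamma> w (Vi i a) \<gamma> e) =
        (\<Sum>r\<in>UNIV. \<Sum>s\<in>UNIV. conn \<Gamma> z (Vi r s) (Vi j b) e * conn \<Gamma> w (Vi i a) (Vi r s) e)"
      by (simp add: sum_index)
    also have "\<dots> = (\<Sum>r\<in>UNIV. \<Sum>s\<in>UNIV.
         of_bool (r = j) * conn_T \<Gamma> z s b e * (of_bool (i = r) * conn_T \<Gamma> w a s e)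
         - of_bool (r = j) * conn_T \<Gamma> z s b e * (of_bool (a = s) * conn_M \<Gamma> w r i e)
         - of_bool (s = b) * conn_M \<Gamma> z j r e * (of_bool (i = r) * conn_T \<Gamma> w a s e)
         + of_bool (s = b) * conn_M \<Gamma> z j r e * (of_bool (a = s) * conn_M \<Gamma> w r i e))"
      unfolding conn_Vi[OF assms] by (intro sum.cong refl) (simp add: algebra_simps)
    also have "\<dots> = of_bool (i = j) * (\<Sum>d\<in>UNIV. conn_T \<Gamma> z d b e * conn_T \<Gamma> w a d e)
      - conn_T \<Gamma> w a b e * conn_M \<Gamma> z j i e - conn_T \<Gamma> z a b e * conn_M \<Gamma> w j i e
      + of_bool (a = b) * (\<Sum>l\<in>UNIV. conn_M \<Gamma> w l i e * conn_M \<Gamma> z j l e)"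
      by (simp only: sum.distrib sum_subtractf tt tm mt mm)
    finally show ?thesis .
  qed
  have vert: "(\<Sum>r\<in>UNIV. \<Sum>s\<in>UNIV. conn \<Gamma> (Vi r s) (Vi i a) (Vi j b) e * bracket N z w r s e) =
      of_bool (i = j) * (\<Sum>r\<in>UNIV. \<Sum>s\<in>UNIV. conn_T \<Gamma> (Vi r s) a b e * bracket N z w r s e)
      - of_bool (a = b) * (\<Sum>r\<in>UNIV. \<Sum>s\<in>UNIV. conn_M \<Gamma> (Vi r s) j i e * bracket N z w r s e)"
    unfolding conn_Vi[OF assms]
    by (simp add: left_diff_distrib sum_subtractf sum_distrib_left mult.assoc)
  show ?thesis
    unfolding curvature_def prod vert lie_conn_Vi[OF assms] curvature_T_eq curvature_M_eq
    by (simp add: algebra_simps)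
qed

lemma curvature_sum_Ti:
  "(\<Sum>\<beta>\<in>UNIV. T [Up \<beta>] e * curvature N \<Gamma> z w (Ti a) \<beta> e) =
    (\<Sum>f\<in>UNIV. T [Up (Ti f)] e * curvature_T N \<Gamma> z w a f e)"
  by (simp add: sum_index curvature_off_diagonal curvature_T_def)

lemma curvature_sum_Mi:
  "(\<Sum>\<beta>\<in>UNIV. T [Up \<beta>] e * curvature N \<Gamma> z w (Mi i) \<beta> e) =
    (\<Sum>r\<in>UNIV. T [Up (Mi r)] e * curvature_M N \<Gamma> z w i r e)"
  by (simp add: sum_index curvature_off_diagonal curvature_M_def)

text \<open>The M-index is covariant, so the M-curvature acts by its negative transpose, while the
  T-curvature acts as on a T-vector. This fixes the signs of the curvature terms in the identities
  for vertical components.\<close>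

lemma curvature_sum_Vi:
  assumes "e \<in> \<Omega>"
  shows "(\<Sum>\<beta>\<in>UNIV. T [Up \<beta>] e * curvature N \<Gamma> z w (Vi i a) \<beta> e) =
    - (\<Sum>r\<in>UNIV. T [Up (Vi r a)] e * curvature_M N \<Gamma> z w r i e)
    + (\<Sum>f\<in>UNIV. T [Up (Vi i f)] e * curvature_T N \<Gamma> z w a f e)"
proof -
  have "(\<Sum>\<beta>\<in>UNIV. T [Up \<beta>] e * curvature N \<Gamma> z w (Vi i a) \<beta> e) =
    (\<Sum>r\<in>UNIV. \<Sum>f\<in>UNIV. of_bool (i = r) * (T [Up (Vi r f)] e * curvature_T N \<Gamma> z w a f e))
    - (\<Sum>r\<in>UNIV. \<Sum>f\<in>UNIV. of_bool (a = f) * (T [Up (Vi r f)] e * curvature_M N \<Gamma> z w r i e))"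
    by (simp add: sum_index curvature_off_diagonal curvature_Vi[OF assms] right_diff_distrib
        sum_subtractf mult.left_commute)
  also have "(\<Sum>r\<in>UNIV. \<Sum>f\<in>UNIV. of_bool (i = r) * (T [Up (Vi r f)] e * curvature_T N \<Gamma> z w a f e)) =
      (\<Sum>f\<in>UNIV. T [Up (Vi i f)] e * curvature_T N \<Gamma> z w a f e)"
    by (subst sum.swap) (simp only: sum_of_bool_mult)
  also have "(\<Sum>r\<in>UNIV. \<Sum>f\<in>UNIV. of_bool (a = f) * (T [Up (Vi r f)] e * curvature_M N \<Gamma> z w r i e)) =
      (\<Sum>r\<in>UNIV. T [Up (Vi r a)] e * curvature_M N \<Gamma> z w r i e)"
    by (simp only: sum_of_bool_mult)
  finally show ?thesis by simp
qed

section \<open>Curvature on the T-components\<close>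

lemma chris_diff: "e \<in> \<Omega> \<Longrightarrow> chris g a b d differentiable at e"
  using differentiable_cong_open[OF open_dom _ A_T] conn_T_diff[of e "Ti d" a b] by simp

lemma lie_A_T:
  assumes "e \<in> \<Omega>"
  shows "lie Z (A_T \<Gamma> a b d) e = lie Z (chris g a b d) e"
  using conn_T_diff[OF assms, of "Ti d"] by (intro lie_cong[OF open_dom assms A_T]) auto

lemma lie_chris_0: "e \<in> \<Omega> \<Longrightarrow> fst (Z e) = 0 \<Longrightarrow> lie Z (chris g a b d) e = 0"
  by (rule lie_const_direction[OF chris_diff]) (auto simp: chris_def)

lemma lie_H_T: "e \<in> \<Omega> \<Longrightarrow> lie Z (H_T \<Gamma> a b i) e = 0"
  using lie_cong[OF open_dom _ H_T, of e] conn_T_diff[of e "Mi i" a b] lie_const[of Z 0 e] by auto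

lemma lie_C_T: "e \<in> \<Omega> \<Longrightarrow> lie Z (C_T \<Gamma> a b i d) e = 0"
  using lie_cong[OF open_dom _ C_T, of e] conn_T_diff[of e "Vi i d" a b] lie_const[of Z 0 e] by auto

lemma curvature_T_Ti_Ti: "e \<in> \<Omega> \<Longrightarrow> curvature_T N \<Gamma> (Ti b) (Ti c) a f e = cur_chi g N a f b c e"
  by (simp add: curvature_T_eq cur_chi_def lie_A_T A_T C_T)

text \<open>The field \<open>delta_x\<close> has no t-component, so Christoffel symbols are constant
  along it; all other terms contain \<open>H_T\<close> or \<open>C_T\<close>, which vanish on
  \<Omega>.\<close>

lemma curvature_T_Ti_Mi: "e \<in> \<Omega> \<Longrightarrow> curvature_T N \<Gamma> (Ti b) (Mi k) a f e = 0"
  by (simp add: curvature_T_eq lie_A_T lie_H_T A_T C_T H_T lie_chris_0 delta_x_def)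

lemma curvature_T_Mi_Mi: "e \<in> \<Omega> \<Longrightarrow> curvature_T N \<Gamma> (Mi j) (Mi k) a f e = 0"
  by (simp add: curvature_T_eq lie_H_T C_T H_T)

lemma curvature_T_Ti_Vi: "e \<in> \<Omega> \<Longrightarrow> curvature_T N \<Gamma> (Ti b) (Vi k c) a f e = 0"
  by (simp add: curvature_T_eq lie_A_T lie_C_T A_T C_T lie_chris_0 part_p_def)

lemma curvature_T_Mi_Vi: "e \<in> \<Omega> \<Longrightarrow> curvature_T N \<Gamma> (Mi j) (Vi k c) a f e = 0"
  by (simp add: curvature_T_eq lie_H_T lie_C_T H_T C_T)

lemma curvature_T_Vi_Vi: "e \<in> \<Omega> \<Longrightarrow> curvature_T N \<Gamma> (Vi j b) (Vi k c) a f e = 0"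
  by (simp add: curvature_T_eq lie_C_T C_T)

section \<open>Curvature on the M-components\<close>

lemma curvature_M_Ti_Ti: "curvature_M N \<Gamma> (Ti b) (Ti c) i r e = cur_R_TT N \<Gamma> i r b c e"
  by (simp add: curvature_M_eq cur_R_TT_def tor_R_TT_def bracket_def)

lemma curvature_M_Ti_Mi: "curvature_M N \<Gamma> (Ti b) (Mi k) i r e = cur_R_TM N \<Gamma> i r b k e"
  by (simp add: curvature_M_eq cur_R_TM_def tor_R_TM_def bracket_def)

lemma curvature_M_Mi_Mi: "curvature_M N \<Gamma> (Mi j) (Mi k) i r e = cur_R_MM N \<Gamma> i r j k e"
  by (simp add: curvature_M_eq cur_R_MM_def tor_R_MM_def bracket_def)

lemma A_V_eq: "e \<in> \<Omega> \<Longrightarrow> A_V \<Gamma> r f c k b e = of_bool (c = f) * A_M \<Gamma> k r b e - of_bool (r = k) * chris g f c b e"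
  using conn_V[of e "Ti b" r f c k] by (auto simp: A_T)

lemma H_V_eq: "e \<in> \<Omega> \<Longrightarrow> H_V \<Gamma> r f c k j e = of_bool (c = f) * H_M \<Gamma> k r j e"
  using conn_V[of e "Mi j" r f c k] by (auto simp: H_T)

lemma C_V_eq: "e \<in> \<Omega> \<Longrightarrow> C_V \<Gamma> r f c k j b e = of_bool (c = f) * C_M \<Gamma> k r j b e"
  using conn_V[of e "Vi j b" r f c k] by (auto simp: C_T)

lemma tor_P_T_eq: "e \<in> \<Omega> \<Longrightarrow> tor_P_T g N \<Gamma> r f b k c e = lie (part_p k c) (N_T N r f b) e + A_V \<Gamma> r f c k b e"
  by (simp add: tor_P_T_def A_V_eq)

lemma tor_P_M_eq: "e \<in> \<Omega> \<Longrightarrow> tor_P_M N \<Gamma> r f j k c e = lie (part_p k c) (N_M N r f j) e + H_V \<Gamma> r f c k j e"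
  by (simp add: tor_P_M_def H_V_eq)

text \<open>The bracket supplies only the part of P that differentiates \<open>N_T\<close>. The
  other part, \<open>A_V\<close>, enters \<open>cur_P_T\<close> through C P and is cancelled by the
  contribution of the slot \<open>Vi k c\<close> to the covariant derivative of C.\<close>

lemma curvature_M_Ti_Vi: "e \<in> \<Omega> \<Longrightarrow> curvature_M N \<Gamma> (Ti b) (Vi k c) i r e = cur_P_T g N \<Gamma> i r b k c e"
  by (simp add: curvature_M_eq cur_P_T_def nabla_C_tensor bracket_def lie_const tor_P_T_eq
      distrib_left sum.distrib mult.commute)

lemma curvature_M_Mi_Vi: "e \<in> \<Omega> \<Longrightarrow> curvature_M N \<Gamma> (Mi j) (Vi k c) i r e = cur_P_M N \<Gamma> i r j k c e"
  by (simp add: curvature_M_eq cur_P_M_def nabla_C_tensor bracket_def lie_const tor_P_M_eq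
      distrib_left sum.distrib mult.commute)

lemma curvature_M_Vi_Vi: "curvature_M N \<Gamma> (Vi j b) (Vi k c) i r e = cur_S \<Gamma> i r j b k c e"
  by (simp add: curvature_M_eq cur_S_def bracket_def lie_const)

section \<open>Torsion contracted with first derivatives\<close>

lemma torsion_Ti_Ti:
  "e \<in> \<Omega> \<Longrightarrow> (\<Sum>\<zeta>\<in>UNIV. U \<zeta> * torsion N \<Gamma> (Ti b) (Ti c) \<zeta> e) =
    (\<Sum>r\<in>UNIV. \<Sum>f\<in>UNIV. U (Vi r f) * tor_R_TT N r f b c e)"
  \<comment> \<open>The T-components of this torsion are antisymmetrized Christoffel
    symbols.\<close>
  using chris_sym[of e _ b c] by (simp add: sum_index torsion_def bracket_def tor_R_TT_def A_T)

lemma torsion_Ti_Mi: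
  "e \<in> \<Omega> \<Longrightarrow> (\<Sum>\<zeta>\<in>UNIV. U \<zeta> * torsion N \<Gamma> (Ti b) (Mi k) \<zeta> e) =
    (\<Sum>r\<in>UNIV. U (Mi r) * tor_T \<Gamma> r b k e) + (\<Sum>r\<in>UNIV. \<Sum>f\<in>UNIV. U (Vi r f) * tor_R_TM N r f b k e)"
  by (simp add: sum_index torsion_def bracket_def tor_R_TM_def tor_T_def H_T)

lemma torsion_Mi_Mi:
  "e \<in> \<Omega> \<Longrightarrow> (\<Sum>\<zeta>\<in>UNIV. U \<zeta> * torsion N \<Gamma> (Mi j) (Mi k) \<zeta> e) =
    (\<Sum>r\<in>UNIV. \<Sum>f\<in>UNIV. U (Vi r f) * tor_R_MM N r f j k e)"
  \<comment> \<open>Here the Cartan type enters: the M-components are \<open>H_M\<close>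
    antisymmetrized in its lower indices.\<close>
  using H_M_sym[of e _ j k] by (simp add: sum_index torsion_def bracket_def tor_R_MM_def)

text \<open>The bracket differentiates \<open>N_T\<close>, and minus the vertical block of
  \<open>conn\<close> contributes \<open>+ A_V\<close>; by \<open>tor_P_T_eq\<close> their sum is
  P.\<close>

lemma torsion_Ti_Vi:
  "e \<in> \<Omega> \<Longrightarrow> (\<Sum>\<zeta>\<in>UNIV. U \<zeta> * torsion N \<Gamma> (Ti b) (Vi k c) \<zeta> e) =
    (\<Sum>r\<in>UNIV. \<Sum>f\<in>UNIV. U (Vi r f) * tor_P_T g N \<Gamma> r f b k c e)"
  by (simp add: sum_index torsion_def bracket_def tor_P_T_eq C_T lie_const add.commute)

lemma torsion_Mi_Vi:
  "e \<in> \<Omega> \<Longrightarrow> (\<Sum>\<zeta>\<in>UNIV. U \<zeta> * torsion N \<Gamma> (Mi j) (Vi k c) \<zeta> e) =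
    (\<Sum>r\<in>UNIV. U (Mi r) * C_M \<Gamma> r j k c e) + (\<Sum>r\<in>UNIV. \<Sum>f\<in>UNIV. U (Vi r f) * tor_P_M N \<Gamma> r f j k c e)"
  by (simp add: sum_index torsion_def bracket_def tor_P_M_eq lie_const add.commute)

text \<open>Vertical frame fields commute, so S comes from the connection coefficients
  alone.\<close>

lemma torsion_Vi_Vi:
  "e \<in> \<Omega> \<Longrightarrow> (\<Sum>\<zeta>\<in>UNIV. U \<zeta> * torsion N \<Gamma> (Vi j b) (Vi k c) \<zeta> e) =
    (\<Sum>r\<in>UNIV. \<Sum>f\<in>UNIV. U (Vi r f) * tor_S \<Gamma> r f j b k c e)"
  by (simp add: sum_index torsion_def bracket_def tor_S_def C_V_eq lie_const)

lemma Ricci: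
  assumes "e \<in> \<Omega>" and "\<And>\<alpha>. Ck_on 2 \<Omega> (T [Up \<alpha>])"
  shows "nabla N \<Gamma> (nabla N \<Gamma> T) [Up \<alpha>, Dn z, Dn w] e - nabla N \<Gamma> (nabla N \<Gamma> T) [Up \<alpha>, Dn w, Dn z] e =
    (\<Sum>\<beta>\<in>UNIV. T [Up \<beta>] e * curvature N \<Gamma> z w \<alpha> \<beta> e)
    - (\<Sum>\<zeta>\<in>UNIV. nabla N \<Gamma> T [Up \<alpha>, Dn \<zeta>] e * torsion N \<Gamma> z w \<zeta> e)"
  by (rule Ricci_identity[where T = T and N = N and \<Gamma> = \<Gamma>, OF open_dom assms(1) assms(2) ncoef_diff[OF assms(1)] conn_diff[OF assms(1)]])

end

section \<open>Consequences of \<open>h\<close>-normality\<close>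

lemma matrix_inv_right_entry:
  fixes A :: "real^'k^'k"
  assumes "det A \<noteq> 0"
  shows "(\<Sum>a\<in>UNIV. A $ c $ a * matrix_inv A $ a $ d) = of_bool (c = d)"
proof -
  have "\<exists>A'. A ** A' = mat 1 \<and> A' ** A = mat 1"
    using assms by (simp add: invertible_det_nz[symmetric] invertible_def)
  then have "A ** matrix_inv A = mat 1"
    unfolding matrix_inv_def by (rule someI_ex[THEN conjunct1])
  then have "(A ** matrix_inv A) $ c $ d = mat 1 $ c $ d" by simp
  then show ?thesis by (simp add: matrix_matrix_mult_def mat_def)
qed

lemma det_nz_ker:
  fixes A :: "real^'k^'k"
  assumes "det A \<noteq> 0" and "\<And>c. (\<Sum>a\<in>UNIV. A $ c $ a * u a) = 0"
  shows "u a = 0"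
proof -
  have "A *v (\<chi> a. u a) = 0"
    using assms(2) by (simp add: matrix_vector_mult_def vec_eq_iff)
  moreover have "inj ((*v) A)"
    using assms(1) by (simp add: inj_matrix_vector_mult invertible_det_nz)
  ultimately have "(\<chi> a. u a) = 0"
    by (metis injD matrix_vector_mult_0_right)
  then show ?thesis by (simp add: vec_eq_iff)
qed

text \<open>Lowering the index cancels the inverse metric and leaves the symbol of the first
  kind.\<close>

lemma christoffel_lower:
  assumes "det (\<chi> a b. h a b t) \<noteq> 0"
  shows "(\<Sum>a\<in>UNIV. h c a t * christoffel h a b g t) =
    (frechet_derivative (h c g) (at t) (axis b 1) + frechet_derivative (h c b) (at t) (axis g 1)
      - frechet_derivative (h b g) (at t) (axis c 1)) / 2"
proof -
  define K where "K d = (frechet_derivative (h d g) (at t) (axis b 1)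
      + frechet_derivative (h d b) (at t) (axis g 1) - frechet_derivative (h b g) (at t) (axis d 1)) / 2" for d
  define I where "I a d = matrix_inv (\<chi> a b. h a b t) $ a $ d" for a d
  have "(\<Sum>a\<in>UNIV. h c a t * christoffel h a b g t) = (\<Sum>a\<in>UNIV. \<Sum>d\<in>UNIV. h c a t * I a d * K d)"
    unfolding christoffel_def by (simp add: K_def I_def sum_distrib_left mult.assoc)
  also have "\<dots> = (\<Sum>d\<in>UNIV. (\<Sum>a\<in>UNIV. h c a t * I a d) * K d)"
    by (subst sum.swap) (simp add: sum_distrib_right)
  also have "\<dots> = (\<Sum>d\<in>UNIV. of_bool (c = d) * K d)"
    using matrix_inv_right_entry[OF assms] by (simp add: I_def)
  also have "\<dots> = K c" by (rule sum_of_bool_mult)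
  finally show ?thesis by (simp add: K_def)
qed

lemma frechet_derivative_metric_sym:
  assumes "open U" and "t \<in> U" and "\<And>t a b. t \<in> U \<Longrightarrow> h a b t = h b a t"
    and "\<And>a b. h a b differentiable at t"
  shows "frechet_derivative (h a b) (at t) = frechet_derivative (h b a) (at t)"
  by (rule frechet_derivative_transform_within_open[OF assms(4,1,2,3)])

lemma christoffel_sym:
  assumes "open U" and "t \<in> U" and "\<And>t a b. t \<in> U \<Longrightarrow> h a b t = h b a t"
    and "\<And>a b. h a b differentiable at t"
  shows "christoffel h a b d t = christoffel h a d b t"
proof -
  have "frechet_derivative (h b d) (at t) = frechet_derivative (h d b) (at t)"
    by (rule frechet_derivative_metric_sym[where h = h, OF assms])
  then show ?thesis by (simp add: christoffel_def add.commute)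
qed

text \<open>This is the parallelism of the metric: when the two symbols of the first kind are added,
  the derivatives along the axes \<open>b\<close> and \<open>c\<close> cancel by symmetry and the
  two halves along \<open>g\<close> add up.\<close>

lemma christoffel_metric:
  assumes "open U" and "t \<in> U" and "\<And>t a b. t \<in> U \<Longrightarrow> h a b t = h b a t"
    and "\<And>a b. h a b differentiable at t" and "det (\<chi> a b. h a b t) \<noteq> 0"
  shows "frechet_derivative (h b c) (at t) (axis g 1) =
    (\<Sum>d\<in>UNIV. h d c t * christoffel h d b g t) + (\<Sum>d\<in>UNIV. h b d t * christoffel h d c g t)"
proof -
  have "h d c t = h c d t" for d by (rule assms(3)[OF assms(2)])
  then show ?thesis
    using frechet_derivative_metric_sym[where h = h and a = b and b = c, OF assms(1-4)]
    by (simp add: christoffel_lower[where h = h and t = t, OF assms(5)] field_simps)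
qed

section \<open>Evaluation of J on frame fields\<close>

lemma lie_comp_fst:
  assumes "f differentiable at (fst e)"
  shows "lie Z (\<lambda>e. f (fst e)) e = frechet_derivative f (at (fst e)) (fst (Z e))"
  by (rule lie_unique[OF has_derivative_compose[OF has_derivative_fst[OF has_derivative_ident]
        frechet_derivative_worksD[OF assms]]])

lemma delta_p_part_p: "delta_p N i a e (part_p j b e) = of_bool (i = j \<and> a = b)"
  by (simp add: delta_p_def part_p_def dt_def dx_def axis_def)

lemma tensor_J_part_p:
  "tensor_J N h e (part_p i a e) v w = (\<Sum>b\<in>UNIV. h a b (fst e) * dt b v * dx i w)"
proof -
  \<comment> \<open>The Kronecker deltas are nested in the order of summation, so that
    \<open>sum_of_bool_mult\<close> removes the sums from the inside.\<close>
  have "tensor_J N h e (part_p i a e) v w = (\<Sum>a'\<in>UNIV. \<Sum>b\<in>UNIV. \<Sum>i'\<in>UNIV. \<Sum>j\<in>UNIV.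
      of_bool (i' = j) * (of_bool (i' = i) * (of_bool (a' = a) * (h a' b (fst e) * dt b v * dx j w))))"
    unfolding tensor_J_def delta_p_part_p
    by (intro sum.cong refl) auto
  also have "\<dots> = (\<Sum>a'\<in>UNIV. \<Sum>b\<in>UNIV. of_bool (a' = a) * (h a' b (fst e) * dt b v * dx i w))"
    unfolding sum_of_bool_mult ..
  also have "\<dots> = (\<Sum>b\<in>UNIV. h a b (fst e) * dt b v * dx i w)"
    by (subst sum.swap) (simp only: sum_of_bool_mult)
  finally show ?thesis .
qed

lemma tensor_J_deltas:
  "tensor_J N h e u (delta_t N b e) (delta_x N i e) = (\<Sum>a\<in>UNIV. h a b (fst e) * delta_p N i a e u)"
proof -
  have "tensor_J N h e u (delta_t N b e) (delta_x N i e) = (\<Sum>a\<in>UNIV. \<Sum>b'\<in>UNIV. \<Sum>i'\<in>UNIV. \<Sum>j\<in>UNIV.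
      of_bool (j = i) * (of_bool (i' = j) * (of_bool (b' = b) * (h a b' (fst e) * delta_p N i' a e u))))"
    unfolding tensor_J_def delta_t_def delta_x_def dt_def dx_def axis_def
    by (intro sum.cong refl) auto
  also have "\<dots> = (\<Sum>a\<in>UNIV. \<Sum>b'\<in>UNIV. of_bool (b' = b) * (h a b' (fst e) * delta_p N i a e u))"
    unfolding sum_of_bool_mult ..
  also have "\<dots> = (\<Sum>a\<in>UNIV. h a b (fst e) * delta_p N i a e u)"
    unfolding sum_of_bool_mult ..
  finally show ?thesis .
qed

section \<open>Smoothness of the coefficients and components\<close>

lemma conn_T_adapted:
  "conn_T (adapted_components N D \<Omega>) z a b e = dt a (D \<Omega> (frame N z) (delta_t N b) e)"
  by (cases z) (simp_all add: adapted_components_def)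

lemma conn_M_adapted:
  "conn_M (adapted_components N D \<Omega>) z i j e = dx i (D \<Omega> (frame N z) (delta_x N j) e)"
  by (cases z) (simp_all add: adapted_components_def)

lemma conn_V_adapted:
  "conn_V (adapted_components N D \<Omega>) z i a b j e = - delta_p N i a e (D \<Omega> (frame N z) (part_p j b) e)"
  by (cases z) (simp_all add: adapted_components_def)

lemma bounded_linear_dt: "bounded_linear (dt a)"
  unfolding dt_def[abs_def] by (rule bounded_linear_compose[OF bounded_linear_vec_nth bounded_linear_fst])

lemma bounded_linear_dx: "bounded_linear (dx i)"
  unfolding dx_def[abs_def]
  by (rule bounded_linear_compose[OF bounded_linear_vec_nth
        bounded_linear_compose[OF bounded_linear_fst bounded_linear_snd]])

lemma smooth_on_delta_p:
  assumes "open S" and "\<And>b. smooth_on S (N_T N i a b)" and "\<And>j. smooth_on S (N_M N i a j)"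
    and "smooth_on S X"
  shows "smooth_on S (\<lambda>e. delta_p N i a e (X e))"
proof -
  have lin: "bounded_linear (\<lambda>v. snd (snd v) $ i $ a)"
    by (rule bounded_linear_compose[OF bounded_linear_vec_nth bounded_linear_compose[OF bounded_linear_vec_nth
          bounded_linear_compose[OF bounded_linear_snd bounded_linear_snd]]])
  show ?thesis
    unfolding delta_p_def
    by (intro smooth_on_add smooth_on_sum smooth_on_bilinear[OF bounded_bilinear_mult] assms
        smooth_on_bounded_linear[OF lin] smooth_on_bounded_linear[OF bounded_linear_dt]
        smooth_on_bounded_linear[OF bounded_linear_dx])
qed

lemma open_jet_dom:
  fixes \<A> :: "('a::{t2_space, second_countable_topology}, 'm::finite) chart set"
    and \<B> :: "('b::{t2_space, second_countable_topology}, 'n::finite) chart set"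
  assumes "smooth_atlas \<A>" and "smooth_atlas \<B>" and "\<kappa> \<in> \<A> \<times> \<B>"
  shows "open (jet_dom \<kappa>)" and "open (snd (fst \<kappa>) ` fst (fst \<kappa>))"
proof -
  have img: "open (snd c ` fst c)" if "smooth_atlas \<C>" "c \<in> \<C>"
    for \<C> :: "('c::{t2_space, second_countable_topology}, 'k::finite) chart set" and c
    using that unfolding smooth_atlas_def by (auto simp: split_def)
  show "open (snd (fst \<kappa>) ` fst (fst \<kappa>))"
    using img assms(1,3) by (metis mem_Times_iff)
  moreover have "open (snd (snd \<kappa>) ` fst (snd \<kappa>))"
    using img assms(2,3) by (metis mem_Times_iff)
  ultimately show "open (jet_dom \<kappa>)"
    unfolding jet_dom_def by (intro open_Times open_UNIV)
qed

lemma smooth_on_ncoef: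
  assumes "nonlinear_connection \<A> \<B> N" and "\<kappa> \<in> \<A> \<times> \<B>"
  shows "smooth_on (jet_dom \<kappa>) (ncoef (N \<kappa>) z r s)"
  using assms unfolding nonlinear_connection_def by (cases z) (auto simp: smooth_on_const)

text \<open>The relation between the vertical and the \<open>M\<close>-coefficients is \<open>J_parallel\<close> evaluated on
  frame fields; the derivative of the metric cancels one Christoffel term, and non-degeneracy of the
  metric removes it from the rest.\<close>

lemma J_parallel_conn_V:
  fixes N :: "('m::finite, 'n::finite) nlc"
  assumes \<Omega>: "open \<Omega>" "e \<in> \<Omega>" and J: "J_parallel N h \<Omega> D"
    and frame: "\<And>z. smooth_on \<Omega> (frame N z)"
    and sym: "\<And>a b. h a b (fst e) = h b a (fst e)" and nz: "det (\<chi> a b. h a b (fst e)) \<noteq> 0"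
    and diff: "\<And>a b. h a b differentiable at (fst e)"
    and \<Gamma>: "\<Gamma> = adapted_components N D \<Omega>"
    and metric: "\<And>b c. frechet_derivative (h b c) (at (fst e)) (fst (frame N z e)) =
      (\<Sum>d\<in>UNIV. h d c (fst e) * conn_T \<Gamma> z d b e) + (\<Sum>d\<in>UNIV. h b d (fst e) * conn_T \<Gamma> z d c e)"
  shows "conn_V \<Gamma> z i a b j e = of_bool (a = b) * conn_M \<Gamma> z j i e - of_bool (i = j) * conn_T \<Gamma> z a b e"
proof -
  have dtx: "dt a (delta_t N b y) = of_bool (a = b)" "dx i (delta_x N j y) = of_bool (i = j)" for a b i j y
    by (auto simp: dt_def dx_def delta_t_def delta_x_def axis_def)
  let ?u = "\<lambda>a. conn_V \<Gamma> z i a b j e - (of_bool (a = b) * conn_M \<Gamma> z j i e - of_bool (i = j) * conn_T \<Gamma> z a b e)"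
  have "(\<Sum>a\<in>UNIV. h c a (fst e) * ?u a) = 0" for c
  proof -
    \<comment> \<open>The arguments match the three factors of J, so its value is the metric
      component \<open>h b c\<close> times a Kronecker delta. Keeping \<open>i\<close> and
      \<open>j\<close> independent yields the off-diagonal coefficients as well.\<close>
    have J': "lie (frame N z) (\<lambda>y. tensor_J N h y (part_p j b y) (delta_t N c y) (delta_x N i y)) e
        - tensor_J N h e (D \<Omega> (frame N z) (part_p j b) e) (delta_t N c e) (delta_x N i e)
        - tensor_J N h e (part_p j b e) (D \<Omega> (frame N z) (delta_t N c) e) (delta_x N i e)
        - tensor_J N h e (part_p j b e) (delta_t N c e) (D \<Omega> (frame N z) (delta_x N i) e) = 0"
      using J \<Omega> frame[of z] frame[of "Vi j b"] frame[of "Ti c"] frame[of "Mi i"]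
      unfolding J_parallel_def by simp
    have "(\<lambda>y. tensor_J N h y (part_p j b y) (delta_t N c y) (delta_x N i y)) =
        (\<lambda>y. of_bool (i = j) * h b c (fst y))"
    proof
      fix y
      have "tensor_J N h y (part_p j b y) (delta_t N c y) (delta_x N i y) =
          (\<Sum>d\<in>UNIV. of_bool (d = c) * (of_bool (i = j) * h b d (fst y)))"
        unfolding tensor_J_part_p dtx by (intro sum.cong refl) auto
      then show "tensor_J N h y (part_p j b y) (delta_t N c y) (delta_x N i y) = of_bool (i = j) * h b c (fst y)"
        unfolding sum_of_bool_mult .
    qed
    moreover have "(\<lambda>y. h b c (fst y)) differentiable at e"
      using differentiable_chain_at[of fst e "h b c"] diff
      by (simp add: o_def differentiableI[OF has_derivative_fst[OF has_derivative_ident]])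
    ultimately have 0: "lie (frame N z) (\<lambda>y. tensor_J N h y (part_p j b y) (delta_t N c y) (delta_x N i y)) e
        = of_bool (i = j) * ((\<Sum>d\<in>UNIV. h d c (fst e) * conn_T \<Gamma> z d b e) + (\<Sum>d\<in>UNIV. h b d (fst e) * conn_T \<Gamma> z d c e))"
      by (simp add: lie_mult lie_const lie_comp_fst[OF diff] metric)
    have 1: "tensor_J N h e (D \<Omega> (frame N z) (part_p j b) e) (delta_t N c e) (delta_x N i e) =
        - (\<Sum>a\<in>UNIV. h a c (fst e) * conn_V \<Gamma> z i a b j e)"
      by (simp add: tensor_J_deltas \<Gamma> conn_V_adapted sum_negf)
    have 2: "tensor_J N h e (part_p j b e) (D \<Omega> (frame N z) (delta_t N c) e) (delta_x N i e) =
        of_bool (i = j) * (\<Sum>d\<in>UNIV. h b d (fst e) * conn_T \<Gamma> z d c e)"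
      by (auto simp: tensor_J_part_p dtx \<Gamma> conn_T_adapted)
    have "tensor_J N h e (part_p j b e) (delta_t N c e) (D \<Omega> (frame N z) (delta_x N i) e) =
        (\<Sum>d\<in>UNIV. of_bool (d = c) * (h b d (fst e) * conn_M \<Gamma> z j i e))"
      unfolding tensor_J_part_p dtx \<Gamma> conn_M_adapted by (intro sum.cong refl) auto
    then have 3: "tensor_J N h e (part_p j b e) (delta_t N c e) (D \<Omega> (frame N z) (delta_x N i) e) =
        h b c (fst e) * conn_M \<Gamma> z j i e"
      unfolding sum_of_bool_mult .
    have "(\<Sum>a\<in>UNIV. h c a (fst e) * ?u a) = (\<Sum>a\<in>UNIV. h c a (fst e) * conn_V \<Gamma> z i a b j e)
        - (\<Sum>a\<in>UNIV. of_bool (a = b) * (h c a (fst e) * conn_M \<Gamma> z j i e))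
        + of_bool (i = j) * (\<Sum>a\<in>UNIV. h c a (fst e) * conn_T \<Gamma> z a b e)"
      by (simp only: right_diff_distrib sum_subtractf sum_distrib_left mult.left_commute[of "of_bool _"])
    also have "(\<Sum>a\<in>UNIV. of_bool (a = b) * (h c a (fst e) * conn_M \<Gamma> z j i e)) = h c b (fst e) * conn_M \<Gamma> z j i e"
      by (rule sum_of_bool_mult)
    finally show ?thesis
      using J' unfolding 0 1 2 3 by (simp add: sym[of _ c] algebra_simps)
  qed
  then have "?u a = 0"
    using det_nz_ker[OF nz, of ?u a] by simp
  then show ?thesis by simp
qed

text \<open>The coefficients \<open>conn_T\<close> and \<open>conn_M\<close> are differentiable
  because \<open>D\<close> sends smooth fields on the whole domain to smooth fields, and the frame
  fields are smooth.\<close>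

lemma h_normal_chart_jet_dom:
  fixes \<A> :: "('a::{t2_space, second_countable_topology}, 'm::finite) chart set"
    and \<B> :: "('b::{t2_space, second_countable_topology}, 'n::finite) chart set"
  assumes atlas: "smooth_atlas \<A>" "smooth_atlas \<B>" and h: "semi_riemannian \<A> h"
    and N: "nonlinear_connection \<A> \<B> N" and D: "h_normal \<A> \<B> h N D"
    and Cartan: "Cartan_type \<A> \<B> N D" and \<kappa>: "\<kappa> \<in> \<A> \<times> \<B>"
  shows "h_normal_chart (jet_dom \<kappa>) (N \<kappa>) (adapted_components (N \<kappa>) (D \<kappa>) (jet_dom \<kappa>)) (h (fst \<kappa>))"
proof -
  define \<Omega> where "\<Omega> = jet_dom \<kappa>"
  define \<Gamma> where "\<Gamma> = adapted_components (N \<kappa>) (D \<kappa>) \<Omega>"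
  define g where "g = h (fst \<kappa>)"
  define U where "U = snd (fst \<kappa>) ` fst (fst \<kappa>)"
  have opn: "open \<Omega>" "open U"
    unfolding \<Omega>_def U_def by (rule open_jet_dom[OF atlas \<kappa>])+
  have fst_U: "fst e \<in> U" if "e \<in> \<Omega>" for e
    using that by (auto simp: \<Omega>_def U_def jet_dom_def)
  have ncoef: "smooth_on \<Omega> (ncoef (N \<kappa>) z r s)" for z r s
    unfolding \<Omega>_def by (rule smooth_on_ncoef[OF N \<kappa>])
  have frame: "smooth_on \<Omega> (frame (N \<kappa>) z)" for z
    by (rule smooth_on_frame[OF opn(1) ncoef])
  have "local_linear_connection \<Omega> (D \<kappa>)"
    using D \<kappa> unfolding h_normal_def N_linear_connection_def linear_connection_def \<Omega>_def by blast
  then have D_smooth: "smooth_on \<Omega> (D \<kappa> \<Omega> X Y)" if "smooth_on \<Omega> X" "smooth_on \<Omega> Y" for X Y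
    using that opn(1) unfolding local_linear_connection_def by blast
  have normal: "A_T \<Gamma> a b d e = chris g a b d e" "H_T \<Gamma> a b i e = 0" "C_T \<Gamma> a b i d e = 0"
    if "e \<in> \<Omega>" for e a b d i
    using D \<kappa> that unfolding h_normal_def \<Omega>_def[symmetric] Let_def \<Gamma>_def g_def by (auto simp: \<Omega>_def)
  have J: "J_parallel (N \<kappa>) g \<Omega> (D \<kappa>)"
    using D \<kappa> unfolding h_normal_def Let_def \<Omega>_def g_def by blast
  have H_sym: "H_M \<Gamma> i j k e = H_M \<Gamma> i k j e" if "e \<in> \<Omega>" for e i j k
    using Cartan \<kappa> that unfolding Cartan_type_def Let_def \<Gamma>_def \<Omega>_def by blast
  have h': "smooth_on U (g a b)" "t \<in> U \<Longrightarrow> g a b t = g b a t" "t \<in> U \<Longrightarrow> det (\<chi> a b. g a b t) \<noteq> 0" for a b t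
    using h \<kappa> unfolding semi_riemannian_def g_def U_def by (auto simp: mem_Times_iff)
  have g_diff: "g a b differentiable at (fst e)" if "e \<in> \<Omega>" for e a b
    by (rule smooth_on_imp_differentiable[OF h'(1) fst_U[OF that]])
  have conn_T: "conn_T \<Gamma> z a b differentiable at e" if "e \<in> \<Omega>" for e z a b
  proof -
    have "conn_T \<Gamma> z a b = (\<lambda>e. dt a (D \<kappa> \<Omega> (frame (N \<kappa>) z) (delta_t (N \<kappa>) b) e))"
      by (rule ext) (simp only: \<Gamma>_def conn_T_adapted)
    then show ?thesis
      using smooth_on_imp_differentiable[OF smooth_on_bounded_linear[OF bounded_linear_dt opn(1)
          D_smooth[OF frame[of z] frame[of "Ti b"]]] that] by simp
  qed
  have conn_M: "conn_M \<Gamma> z i j differentiable at e" if "e \<in> \<Omega>" for e z i j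
  proof -
    have "conn_M \<Gamma> z i j = (\<lambda>e. dx i (D \<kappa> \<Omega> (frame (N \<kappa>) z) (delta_x (N \<kappa>) j) e))"
      by (rule ext) (simp only: \<Gamma>_def conn_M_adapted)
    then show ?thesis
      using smooth_on_imp_differentiable[OF smooth_on_bounded_linear[OF bounded_linear_dx opn(1)
          D_smooth[OF frame[of z] frame[of "Mi j"]]] that] by simp
  qed
  have metric: "frechet_derivative (g b c) (at (fst e)) (fst (frame (N \<kappa>) z e)) =
      (\<Sum>d\<in>UNIV. g d c (fst e) * conn_T \<Gamma> z d b e) + (\<Sum>d\<in>UNIV. g b d (fst e) * conn_T \<Gamma> z d c e)"
    if e: "e \<in> \<Omega>" for e z b c
  proof (cases z)
    case (Ti f)
    then show ?thesis
      using christoffel_metric[where h = g, OF opn(2) fst_U[OF e] h'(2) g_diff[OF e] h'(3)[OF fst_U[OF e]], of b c f]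
      by (simp add: normal[OF e] chris_def delta_t_def)
  next
    \<comment> \<open>The direction has no t-component, so the metric is differentiated along the
      zero vector; the right-hand side vanishes with \<open>H_T\<close>.\<close>
    case (Mi i)
    then show ?thesis
      using linear_0[OF linear_frechet_derivative[OF g_diff[OF e]]] by (simp add: normal[OF e] delta_x_def)
  next
    case (Vi i f)
    then show ?thesis
      using linear_0[OF linear_frechet_derivative[OF g_diff[OF e]]] by (simp add: normal[OF e] part_p_def)
  qed
  have "h_normal_chart \<Omega> (N \<kappa>) \<Gamma> g"
  proof
    show "conn_V \<Gamma> z i a b j e = of_bool (a = b) * conn_M \<Gamma> z j i e - of_bool (i = j) * conn_T \<Gamma> z a b e"
      if "e \<in> \<Omega>" for e z i a b j
      by (rule J_parallel_conn_V[OF opn(1) that J frame h'(2)[OF fst_U[OF that]] h'(3)[OF fst_U[OF that]]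
            g_diff[OF that] \<Gamma>_def metric[OF that]])
    show "chris g a b d e = chris g a d b e" if "e \<in> \<Omega>" for e a b d
      unfolding chris_def by (rule christoffel_sym[where h = g, OF opn(2) fst_U[OF that] h'(2) g_diff[OF that]])
  qed (use opn normal H_sym conn_T conn_M smooth_on_imp_differentiable[OF ncoef] in auto)
  then show ?thesis by (simp only: \<Gamma>_def \<Omega>_def g_def)
qed

lemma smooth_on_vf_components:
  assumes \<Omega>: "open \<Omega>" and N: "\<And>z r s. smooth_on \<Omega> (ncoef N z r s)" and X: "smooth_on \<Omega> X"
  shows "smooth_on \<Omega> (vf_components N X [Up \<alpha>])"
proof (cases \<alpha>)
  case (Ti a)
  then show ?thesis
    using smooth_on_bounded_linear[OF bounded_linear_dt \<Omega> X] by (simp add: vf_components_def[abs_def])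
next
  case (Mi i)
  then show ?thesis
    using smooth_on_bounded_linear[OF bounded_linear_dx \<Omega> X] by (simp add: vf_components_def[abs_def])
next
  case (Vi i a)
  have "smooth_on \<Omega> (N_T N i a b)" "smooth_on \<Omega> (N_M N i a j)" for b j
    using N[of "Ti b" i a] N[of "Mi j" i a] by simp_all
  with Vi show ?thesis
    using smooth_on_delta_p[OF \<Omega> _ _ X] by (simp add: vf_components_def[abs_def])
qed

theorem theorem5p4:
  fixes \<A> :: "('a::{t2_space, second_countable_topology}, 'm::finite) chart set"
    and \<B> :: "('b::{t2_space, second_countable_topology}, 'n::finite) chart set"
    and h :: "('a, 'm) chart \<Rightarrow> 'm \<Rightarrow> 'm \<Rightarrow> real^'m \<Rightarrow> real"
    and N :: "('a, 'm, 'b, 'n) jet_chart \<Rightarrow> ('m, 'n) nlc"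
    and D :: "('a, 'm, 'b, 'n) jet_chart \<Rightarrow> ('m, 'n) local_conn"
    and X :: "('a, 'm, 'b, 'n) jet_chart \<Rightarrow> ('m, 'n) vfield"
    and \<kappa> :: "('a, 'm, 'b, 'n) jet_chart"
    and e :: "('m, 'n) jet"
    and a b c :: 'm and i j k :: 'n
    and g :: "'m \<Rightarrow> 'm \<Rightarrow> real^'m \<Rightarrow> real"
    and \<eta> :: "('m, 'n) nlc"
    and \<Gamma> :: "('m, 'n) components"
    and \<X> :: "('m, 'n) dtensor"
    and DD :: "('m, 'n) dtensor \<Rightarrow> ('m, 'n) dtensor"
  assumes "smooth_atlas \<A>" and "smooth_atlas \<B>"
    and "semi_riemannian \<A> h"
    and "nonlinear_connection \<A> \<B> N"
    and "h_normal \<A> \<B> h N D"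
    and "Cartan_type \<A> \<B> N D"
    and "vector_field \<A> \<B> X"
    and "\<kappa> \<in> \<A> \<times> \<B>" and "e \<in> jet_dom \<kappa>"
    and "g = h (fst \<kappa>)" and "\<eta> = N \<kappa>"
    and "\<Gamma> = adapted_components (N \<kappa>) (D \<kappa>) (jet_dom \<kappa>)"
    and "\<X> = vf_components (N \<kappa>) (X \<kappa>)"
    and "DD = nabla \<eta> \<Gamma>"
  shows
    "(DD (DD \<X>) [Up (Ti a), Dn (Ti b), Dn (Ti c)] e - DD (DD \<X>) [Up (Ti a), Dn (Ti c), Dn (Ti b)] e =
           (\<Sum>f\<in>UNIV. \<X> [Up (Ti f)] e * cur_chi g \<eta> a f b c e)
           - (\<Sum>r\<in>UNIV. \<Sum>f\<in>UNIV. DD \<X> [Up (Ti a), Dn (Vi r f)] e * tor_R_TT \<eta> r f b c e)) \<and>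
     (DD (DD \<X>) [Up (Ti a), Dn (Ti b), Dn (Mi k)] e - DD (DD \<X>) [Up (Ti a), Dn (Mi k), Dn (Ti b)] e =
           - (\<Sum>r\<in>UNIV. DD \<X> [Up (Ti a), Dn (Mi r)] e * tor_T \<Gamma> r b k e)
           - (\<Sum>r\<in>UNIV. \<Sum>f\<in>UNIV. DD \<X> [Up (Ti a), Dn (Vi r f)] e * tor_R_TM \<eta> r f b k e)) \<and>
     (DD (DD \<X>) [Up (Ti a), Dn (Mi j), Dn (Mi k)] e - DD (DD \<X>) [Up (Ti a), Dn (Mi k), Dn (Mi j)] e =
           - (\<Sum>r\<in>UNIV. \<Sum>f\<in>UNIV. DD \<X> [Up (Ti a), Dn (Vi r f)] e * tor_R_MM \<eta> r f j k e)) \<and>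
     (DD (DD \<X>) [Up (Ti a), Dn (Ti b), Dn (Vi k c)] e - DD (DD \<X>) [Up (Ti a), Dn (Vi k c), Dn (Ti b)] e =
           - (\<Sum>r\<in>UNIV. \<Sum>f\<in>UNIV. DD \<X> [Up (Ti a), Dn (Vi r f)] e * tor_P_T g \<eta> \<Gamma> r f b k c e)) \<and>
     (DD (DD \<X>) [Up (Ti a), Dn (Mi j), Dn (Vi k c)] e - DD (DD \<X>) [Up (Ti a), Dn (Vi k c), Dn (Mi j)] e =
           - (\<Sum>r\<in>UNIV. DD \<X> [Up (Ti a), Dn (Mi r)] e * C_M \<Gamma> r j k c e)
           - (\<Sum>r\<in>UNIV. \<Sum>f\<in>UNIV. DD \<X> [Up (Ti a), Dn (Vi r f)] e * tor_P_M \<eta> \<Gamma> r f j k c e)) \<and>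
     (DD (DD \<X>) [Up (Ti a), Dn (Vi j b), Dn (Vi k c)] e - DD (DD \<X>) [Up (Ti a), Dn (Vi k c), Dn (Vi j b)] e =
           - (\<Sum>r\<in>UNIV. \<Sum>f\<in>UNIV. DD \<X> [Up (Ti a), Dn (Vi r f)] e * tor_S \<Gamma> r f j b k c e)) \<and>
     (DD (DD \<X>) [Up (Mi i), Dn (Ti b), Dn (Ti c)] e - DD (DD \<X>) [Up (Mi i), Dn (Ti c), Dn (Ti b)] e =
           (\<Sum>r\<in>UNIV. \<X> [Up (Mi r)] e * cur_R_TT \<eta> \<Gamma> i r b c e)
           - (\<Sum>r\<in>UNIV. \<Sum>f\<in>UNIV. DD \<X> [Up (Mi i), Dn (Vi r f)] e * tor_R_TT \<eta> r f b c e)) \<and>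
     (DD (DD \<X>) [Up (Mi i), Dn (Ti b), Dn (Mi k)] e - DD (DD \<X>) [Up (Mi i), Dn (Mi k), Dn (Ti b)] e =
           (\<Sum>r\<in>UNIV. \<X> [Up (Mi r)] e * cur_R_TM \<eta> \<Gamma> i r b k e)
           - (\<Sum>r\<in>UNIV. DD \<X> [Up (Mi i), Dn (Mi r)] e * tor_T \<Gamma> r b k e)
           - (\<Sum>r\<in>UNIV. \<Sum>f\<in>UNIV. DD \<X> [Up (Mi i), Dn (Vi r f)] e * tor_R_TM \<eta> r f b k e)) \<and>
     (DD (DD \<X>) [Up (Mi i), Dn (Mi j), Dn (Mi k)] e - DD (DD \<X>) [Up (Mi i), Dn (Mi k), Dn (Mi j)] e =
           (\<Sum>r\<in>UNIV. \<X> [Up (Mi r)] e * cur_R_MM \<eta> \<Gamma> i r j k e)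
           - (\<Sum>r\<in>UNIV. \<Sum>f\<in>UNIV. DD \<X> [Up (Mi i), Dn (Vi r f)] e * tor_R_MM \<eta> r f j k e)) \<and>
     (DD (DD \<X>) [Up (Mi i), Dn (Ti b), Dn (Vi k c)] e - DD (DD \<X>) [Up (Mi i), Dn (Vi k c), Dn (Ti b)] e =
           (\<Sum>r\<in>UNIV. \<X> [Up (Mi r)] e * cur_P_T g \<eta> \<Gamma> i r b k c e)
           - (\<Sum>r\<in>UNIV. \<Sum>f\<in>UNIV. DD \<X> [Up (Mi i), Dn (Vi r f)] e * tor_P_T g \<eta> \<Gamma> r f b k c e)) \<and>
     (DD (DD \<X>) [Up (Mi i), Dn (Mi j), Dn (Vi k c)] e - DD (DD \<X>) [Up (Mi i), Dn (Vi k c), Dn (Mi j)] e =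
           (\<Sum>r\<in>UNIV. \<X> [Up (Mi r)] e * cur_P_M \<eta> \<Gamma> i r j k c e)
           - (\<Sum>r\<in>UNIV. DD \<X> [Up (Mi i), Dn (Mi r)] e * C_M \<Gamma> r j k c e)
           - (\<Sum>r\<in>UNIV. \<Sum>f\<in>UNIV. DD \<X> [Up (Mi i), Dn (Vi r f)] e * tor_P_M \<eta> \<Gamma> r f j k c e)) \<and>
     (DD (DD \<X>) [Up (Mi i), Dn (Vi j b), Dn (Vi k c)] e - DD (DD \<X>) [Up (Mi i), Dn (Vi k c), Dn (Vi j b)] e =
           (\<Sum>r\<in>UNIV. \<X> [Up (Mi r)] e * cur_S \<Gamma> i r j b k c e)
           - (\<Sum>r\<in>UNIV. \<Sum>f\<in>UNIV. DD \<X> [Up (Mi i), Dn (Vi r f)] e * tor_S \<Gamma> r f j b k c e)) \<and>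
     (DD (DD \<X>) [Up (Vi i a), Dn (Ti b), Dn (Ti c)] e - DD (DD \<X>) [Up (Vi i a), Dn (Ti c), Dn (Ti b)] e =
           - (\<Sum>r\<in>UNIV. \<X> [Up (Vi r a)] e * cur_R_TT \<eta> \<Gamma> r i b c e)
           + (\<Sum>f\<in>UNIV. \<X> [Up (Vi i f)] e * cur_chi g \<eta> a f b c e)
           - (\<Sum>r\<in>UNIV. \<Sum>f\<in>UNIV. DD \<X> [Up (Vi i a), Dn (Vi r f)] e * tor_R_TT \<eta> r f b c e)) \<and>
     (DD (DD \<X>) [Up (Vi i a), Dn (Ti b), Dn (Mi k)] e - DD (DD \<X>) [Up (Vi i a), Dn (Mi k), Dn (Ti b)] e =
           - (\<Sum>r\<in>UNIV. \<X> [Up (Vi r a)] e * cur_R_TM \<eta> \<Gamma> r i b k e)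
           - (\<Sum>r\<in>UNIV. DD \<X> [Up (Vi i a), Dn (Mi r)] e * tor_T \<Gamma> r b k e)
           - (\<Sum>r\<in>UNIV. \<Sum>f\<in>UNIV. DD \<X> [Up (Vi i a), Dn (Vi r f)] e * tor_R_TM \<eta> r f b k e)) \<and>
     (DD (DD \<X>) [Up (Vi i a), Dn (Mi j), Dn (Mi k)] e - DD (DD \<X>) [Up (Vi i a), Dn (Mi k), Dn (Mi j)] e =
           - (\<Sum>r\<in>UNIV. \<X> [Up (Vi r a)] e * cur_R_MM \<eta> \<Gamma> r i j k e)
           - (\<Sum>r\<in>UNIV. \<Sum>f\<in>UNIV. DD \<X> [Up (Vi i a), Dn (Vi r f)] e * tor_R_MM \<eta> r f j k e)) \<and>
     (DD (DD \<X>) [Up (Vi i a), Dn (Ti b), Dn (Vi k c)] e - DD (DD \<X>) [Up (Vi i a), Dn (Vi k c), Dn (Ti b)] e =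
           - (\<Sum>r\<in>UNIV. \<X> [Up (Vi r a)] e * cur_P_T g \<eta> \<Gamma> r i b k c e)
           - (\<Sum>r\<in>UNIV. \<Sum>f\<in>UNIV. DD \<X> [Up (Vi i a), Dn (Vi r f)] e * tor_P_T g \<eta> \<Gamma> r f b k c e)) \<and>
     (DD (DD \<X>) [Up (Vi i a), Dn (Mi j), Dn (Vi k c)] e - DD (DD \<X>) [Up (Vi i a), Dn (Vi k c), Dn (Mi j)] e =
           - (\<Sum>r\<in>UNIV. \<X> [Up (Vi r a)] e * cur_P_M \<eta> \<Gamma> r i j k c e)
           - (\<Sum>r\<in>UNIV. DD \<X> [Up (Vi i a), Dn (Mi r)] e * C_M \<Gamma> r j k c e)
           - (\<Sum>r\<in>UNIV. \<Sum>f\<in>UNIV. DD \<X> [Up (Vi i a), Dn (Vi r f)] e * tor_P_M \<eta> \<Gamma> r f j k c e)) \<and>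
     (DD (DD \<X>) [Up (Vi i a), Dn (Vi j b), Dn (Vi k c)] e - DD (DD \<X>) [Up (Vi i a), Dn (Vi k c), Dn (Vi j b)] e =
           - (\<Sum>r\<in>UNIV. \<X> [Up (Vi r a)] e * cur_S \<Gamma> r i j b k c e)
           - (\<Sum>r\<in>UNIV. \<Sum>f\<in>UNIV. DD \<X> [Up (Vi i a), Dn (Vi r f)] e * tor_S \<Gamma> r f j b k c e))"
proof -
  define \<Omega> where "\<Omega> = jet_dom \<kappa>"
  have e: "e \<in> \<Omega>" using assms(9) by (simp add: \<Omega>_def)
  interpret h_normal_chart \<Omega> \<eta> \<Gamma> g
    using h_normal_chart_jet_dom[OF assms(1-6,8)] unfolding assms(10,11,12) \<Omega>_def .
  have X: "smooth_on \<Omega> (X \<kappa>)" using assms(7,8) unfolding vector_field_def \<Omega>_def by blast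
  have "smooth_on \<Omega> (\<X> [Up \<alpha>])" for \<alpha>
    unfolding assms(13) \<Omega>_def
    by (rule smooth_on_vf_components[OF open_jet_dom(1)[OF assms(1,2,8)] smooth_on_ncoef[OF assms(4,8)]
          X[unfolded \<Omega>_def]])
  then have \<X>: "Ck_on 2 \<Omega> (\<X> [Up \<alpha>])" for \<alpha> by (simp add: smooth_on_def)
  note Ricci = Ricci[where T = \<X>, OF e \<X>, folded assms(14)]
  note curv_T = curvature_T_Ti_Ti[OF e] curvature_T_Ti_Mi[OF e] curvature_T_Mi_Mi[OF e]
    curvature_T_Ti_Vi[OF e] curvature_T_Mi_Vi[OF e] curvature_T_Vi_Vi[OF e]
  note curv_M = curvature_M_Ti_Ti curvature_M_Ti_Mi curvature_M_Mi_Mi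
    curvature_M_Ti_Vi[OF e] curvature_M_Mi_Vi[OF e] curvature_M_Vi_Vi
  note tors = torsion_Ti_Ti[OF e] torsion_Ti_Mi[OF e] torsion_Mi_Mi[OF e]
    torsion_Ti_Vi[OF e] torsion_Mi_Vi[OF e] torsion_Vi_Vi[OF e]
  \<comment> \<open>Every left-hand side is an instance of \<open>Ricci\<close>. The upper index
    selects the curvature sum, the pair of directions selects the entries of \<open>curv_T\<close>,
    \<open>curv_M\<close> and \<open>tors\<close>; \<open>simp\<close> then discards the sums over
    vanishing \<open>curvature_T\<close>.\<close>
  show ?thesis
    unfolding Ricci curvature_sum_Ti curvature_sum_Mi curvature_sum_Vi[OF e] curv_T curv_M tors
    by simp
qed

end
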